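(* Let $\mathcal{L}=\bigoplus_{i\in\mathbb{Z}^+}\mathbb{C}[\partial]L_i$ be a $\mathbb{Z}^+$-graded Lie conformal algebra, where each $\mathbb{C}[\partial]L_i$ is a free $\mathbb{C}[\partial]$-module of rank one and $[{L_i}_\lambda L_j]=p_{i,j}(\partial,\lambda)L_{i+j}$ with $p_{i,j}(\partial,\lambda)\in\mathbb{C}[\partial,\lambda]$. Assume that $[{L_0}_\lambda L_0]=(\partial+2\lambda)L_0$ and that $[{L_1}_\lambda L_i]\neq 0$ for all $i\in\mathbb{Z}^+$. Then $\mathcal{L}$ does not have non-trivial faithful finite modules.
   Context: $\mathbb{Z}^+$ is the set of nonnegative integers; everything is over $\mathbb{C}$. A Lie conformal algebra $\mathcal{A}$ is a $\mathbb{C}[\partial]$-module with a $\mathbb{C}$-bilinear $\lambda$-bracket $[\cdot_\lambda\cdot]:\mathcal{A}\otimes\mathcal{A}\to\mathcal{A}[\lambda]$ such that $[\partial a_\lambda b]=-\lambda[a_\lambda b]$, $[a_\lambda\partial b]=(\partial+\lambda)[a_\lambda b]$, $[a_\lambda b]=-[b_{-\lambda-\partial}a]$, and $[a_\lambda[b_\mu c]]=[[a_\lambda b]_{\lambda+\mu}c]+[b_\mu[a_\lambda c]]$. An $\mathcal{A}$-module is a $\mathbb{C}[\partial]$-module $M$ with a $\mathbb{C}$-linear map $\mathcal{A}\otimes M\to M[\lambda]$, $a\otimes m\mapsto a_\lambda m$, such that $(\partial a)_\lambda m=-\lambda a_\lambda m$, $a_\lambda(\partial m)=(\partial+\lambda)a_\lambda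 m$, $a_\lambda(b_\mu m)=[a_\lambda b]_{\lambda+\mu}m+b_\mu(a_\lambda m)$. A module is finite if finitely generated over $\mathbb{C}[\partial]$, trivial if $a_\lambda m=0$ for all $a,m$, and faithful if no nonzero $a\in\mathcal{A}$ satisfies $a_\lambda m=0$ for all $m$. *)

theory Defs
  imports "HOL-Computational_Algebra.Polynomial"
begin

text \<open>
  A module over the ring of polynomials in \<open>\<partial>\<close> with complex coefficients is an instance of the
  library locale \<^locale>\<open>module\<close> with scalars \<^typ>\<open>complex poly\<close>: \<open>\<partial>\<close> acts as the scalar
  \<^term>\<open>[:0, 1:] :: complex poly\<close> and a complex number \<open>c\<close> as \<^term>\<open>[:c:] :: complex poly\<close>.
  For an abelian group \<open>V\<close>, the group \<open>V[\<lambda>]\<close> is \<open>V poly\<close>, and \<open>V[\<lambda>, \<mu>]\<close> is \<open>V poly poly\<close>, where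
  the outer variable is \<open>\<mu>\<close> and the inner variable is \<open>\<lambda>\<close>.
\<close>

abbreviation (input) partial :: "(complex poly \<Rightarrow> 'v \<Rightarrow> 'v) \<Rightarrow> 'v \<Rightarrow> 'v" where
  "partial scale \<equiv> scale [:0, 1:]"

text \<open>Multiplication by \<open>\<lambda>\<close> on \<open>V[\<lambda>]\<close>, and by \<open>\<lambda>\<close> and \<open>\<mu>\<close> on \<open>V[\<lambda>, \<mu>]\<close>.\<close>

definition mult_var :: "'v::ab_group_add poly \<Rightarrow> 'v poly" where
  "mult_var u = pCons 0 u"

definition mult_lam :: "'v::ab_group_add poly poly \<Rightarrow> 'v poly poly" where
  "mult_lam u = map_poly (pCons 0) u"

definition mult_mu :: "'v::ab_group_add poly poly \<Rightarrow> 'v poly poly" where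
  "mult_mu u = pCons 0 u"

text \<open>
  For \<open>u = \<Sum>n. \<lambda>^n v\<^sub>n\<close> this is \<open>\<Sum>n. X^n (f v\<^sub>n)\<close>: the variable is replaced by the
  operator \<open>X\<close>, and the coefficients are mapped by \<open>f\<close>.
\<close>

definition subst_var ::
  "('v \<Rightarrow> 'w) \<Rightarrow> ('w \<Rightarrow> 'w) \<Rightarrow> 'v::ab_group_add poly \<Rightarrow> 'w::ab_group_add" where
  "subst_var f X u = (\<Sum>n\<le>degree u. (X ^^ n) (f (coeff u n)))"

text \<open>The element \<open>P(\<partial>, \<lambda>) v\<close> of \<open>V[\<lambda>]\<close>; \<open>P\<close> has outer variable \<open>\<lambda>\<close> and inner variable \<open>\<partial>\<close>.\<close>

definition poly2_scale ::
  "(complex poly \<Rightarrow> 'v \<Rightarrow> 'v) \<Rightarrow> complex poly poly \<Rightarrow> 'v::ab_group_add \<Rightarrow> 'v poly" where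
  "poly2_scale scale P v = map_poly (\<lambda>q. scale q v) P"

text \<open>
  The three terms of the Jacobi identity in \<open>V[\<lambda>, \<mu>]\<close>, for an action \<open>a\<^sub>\<lambda> m\<close> given by \<open>act a m\<close>:
  \<open>a\<^sub>\<lambda> (b\<^sub>\<mu> m)\<close>, \<open>b\<^sub>\<mu> (a\<^sub>\<lambda> m)\<close> and \<open>[a\<^sub>\<lambda> b]\<^sub>\<lambda>\<^sub>+\<^sub>\<mu> m\<close>.
\<close>

definition lam_mu_act ::
  "('a \<Rightarrow> 'v \<Rightarrow> 'v::ab_group_add poly) \<Rightarrow> 'a \<Rightarrow> 'a \<Rightarrow> 'v \<Rightarrow> 'v poly poly" where
  "lam_mu_act act a b m = subst_var (\<lambda>x. [:act a x:]) mult_mu (act b m)"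

definition mu_lam_act ::
  "('a \<Rightarrow> 'v \<Rightarrow> 'v::ab_group_add poly) \<Rightarrow> 'a \<Rightarrow> 'a \<Rightarrow> 'v \<Rightarrow> 'v poly poly" where
  "mu_lam_act act b a m =
     subst_var (\<lambda>x. map_poly (\<lambda>y. [:y:]) (act b x)) mult_lam (act a m)"

definition bracket_act ::
  "('a \<Rightarrow> 'a \<Rightarrow> 'a::ab_group_add poly) \<Rightarrow> ('a \<Rightarrow> 'v \<Rightarrow> 'v::ab_group_add poly) \<Rightarrow>
     'a \<Rightarrow> 'a \<Rightarrow> 'v \<Rightarrow> 'v poly poly" where
  "bracket_act br act a b m =
     subst_var
       (\<lambda>x. subst_var (\<lambda>y. [:[:y:]:]) (\<lambda>u. mult_lam u + mult_mu u) (act x m))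
       mult_lam (br a b)"

locale lie_conformal_algebra = module scale
  for scale :: "complex poly \<Rightarrow> 'a::ab_group_add \<Rightarrow> 'a" +
  fixes br :: "'a \<Rightarrow> 'a \<Rightarrow> 'a poly"
  assumes br_add_left: "br (a + b) c = br a c + br b c"
    and br_add_right: "br a (b + c) = br a b + br a c"
    and br_scale_left: "br (scale [:t:] a) b = map_poly (scale [:t:]) (br a b)"
    and br_scale_right: "br a (scale [:t:] b) = map_poly (scale [:t:]) (br a b)"
    and br_partial_left: "br (partial scale a) b = - mult_var (br a b)"
    and br_partial_right:
      "br a (partial scale b) = map_poly (partial scale) (br a b) + mult_var (br a b)"
    and br_skew:
      "br a b =
         - subst_var (\<lambda>x. [:x:]) (\<lambda>u. - mult_var u - map_poly (partial scale) u) (br b a)"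
    and br_jacobi:
      "lam_mu_act br a b c = bracket_act br br a b c + mu_lam_act br b a c"

locale lie_conformal_module =
  lie_conformal_algebra scale br + M: module scaleM
  for scale :: "complex poly \<Rightarrow> 'a::ab_group_add \<Rightarrow> 'a"
    and br :: "'a \<Rightarrow> 'a \<Rightarrow> 'a poly"
    and scaleM :: "complex poly \<Rightarrow> 'm::ab_group_add \<Rightarrow> 'm" +
  fixes act :: "'a \<Rightarrow> 'm \<Rightarrow> 'm poly"
  assumes act_add_left: "act (a + b) m = act a m + act b m"
    and act_add_right: "act a (m + n) = act a m + act a n"
    and act_scale_left: "act (scale [:t:] a) m = map_poly (scaleM [:t:]) (act a m)"
    and act_scale_right: "act a (scaleM [:t:] m) = map_poly (scaleM [:t:]) (act a m)"
    and act_partial_left: "act (partial scale a) m = - mult_var (act a m)"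
    and act_partial_right:
      "act a (partial scaleM m) = map_poly (partial scaleM) (act a m) + mult_var (act a m)"
    and act_jacobi:
      "lam_mu_act act a b m = bracket_act br act a b m + mu_lam_act act b a m"

definition finite_module :: "(complex poly \<Rightarrow> 'm::ab_group_add \<Rightarrow> 'm) \<Rightarrow> bool" where
  "finite_module scaleM \<longleftrightarrow> (\<exists>S. finite S \<and> module.span scaleM S = UNIV)"

definition trivial_action :: "('a \<Rightarrow> 'm \<Rightarrow> 'm::ab_group_add poly) \<Rightarrow> bool" where
  "trivial_action act \<longleftrightarrow> (\<forall>a m. act a m = 0)"

definition faithful_action :: "('a::ab_group_add \<Rightarrow> 'm \<Rightarrow> 'm::ab_group_add poly) \<Rightarrow> bool" where
  "faithful_action act \<longleftrightarrow> \<not> (\<exists>a. a \<noteq> 0 \<and> (\<forall>m. act a m = 0))"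

text \<open>
  The module is the internal direct sum of the cyclic submodules generated by the \<open>L i\<close>, each of
  which is free of rank one on the generator \<open>L i\<close>.
\<close>

definition free_graded_by ::
  "(complex poly \<Rightarrow> 'a::ab_group_add \<Rightarrow> 'a) \<Rightarrow> (nat \<Rightarrow> 'a) \<Rightarrow> bool" where
  "free_graded_by scale L \<longleftrightarrow>
     (\<forall>i. inj (\<lambda>q. scale q (L i))) \<and>
     (\<forall>x. \<exists>!y. (\<forall>i. y i \<in> range (\<lambda>q. scale q (L i))) \<and> finite {i. y i \<noteq> 0} \<and>
        x = (\<Sum>i | y i \<noteq> 0. y i))"

end

theory Submission
  imports Defs "HOL-Computational_Algebra.Fundamental_Theorem_Algebra"
begin

text \<open>
  Since \<open>[L\<^sub>1 \<^sub>\<lambda> L\<^sub>i] \<noteq> 0\<close>, one has \<open>[L\<^sub>0 \<^sub>\<lambda> L\<^sub>i] = (\<partial> + i\<alpha> + \<Delta>\<^sub>i \<lambda>) L\<^sub>i\<close> for all \<open>i\<close>. Let \<open>M\<close> be a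
  finite module and \<open>Z\<close> the submodule killed by \<open>L\<^sub>0\<close>; every \<open>L\<^sub>i\<close> kills \<open>Z\<close>. The operator
  \<open>T = (L\<^sub>0)\<^sub>(\<^sub>0\<^sub>) - \<partial>\<close> commutes with \<open>\<partial>\<close> and \<open>L\<^sub>0\<close>, equals \<open>-\<partial>\<close> on \<open>Z\<close>, and \<open>h(T) M \<subseteq> Z\<close> for some
  nonzero polynomial \<open>h\<close>.

  Since \<open>T\<close> shifts by \<open>i\<alpha>\<close> under \<open>L\<^sub>i\<close>, a nonzero action of \<open>L\<^sub>i\<close> forces \<open>i\<alpha>\<close> into a finite set given
  by the roots of \<open>h\<close> and the eigenvalues of \<open>\<partial>\<close> on the torsion of \<open>M\<close>. Hence \<open>\<alpha> = 0\<close> if \<open>M\<close> is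
  faithful. In that case the degrees in \<open>\<lambda>\<close> of the \<open>L\<^sub>i \<^sub>\<lambda> v\<close> are bounded uniformly in \<open>i\<close>, and all
  their coefficients lie in a finite-dimensional space. So infinitely many \<open>L\<^sub>i\<close> act on the
  generators through a finite-dimensional space of maps, and a nontrivial linear combination of
  them acts by zero.
\<close>

section \<open>Linear algebra\<close>

definition fin_span :: "('f::field \<Rightarrow> 'v::ab_group_add \<Rightarrow> 'v) \<Rightarrow> 'v set \<Rightarrow> bool" where
  "fin_span s S \<longleftrightarrow> (\<exists>B. finite B \<and> S \<subseteq> module.span s B)"

lemma fin_span_subset: "fin_span s S \<Longrightarrow> R \<subseteq> S \<Longrightarrow> fin_span s R"
  unfolding fin_span_def by blast

context vector_space_pair
begin

text \<open>Rank-nullity: preimages in \<open>S\<close> of a basis of the image, together with a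
  finite spanning set of the kernel in \<open>S\<close>, span \<open>S\<close>.\<close>

lemma fin_span_of_kernel:
  assumes f: "Vector_Spaces.linear s1 s2 f" and S: "vs1.subspace S"
    and img: "fin_span s2 (f ` S)" and ker: "fin_span s1 (S \<inter> {x. f x = 0})"
  shows "fin_span s1 S"
proof -
  interpret f: Vector_Spaces.linear s1 s2 f by (rule f)
  obtain C where C: "finite C" "f ` S \<subseteq> vs2.span C"
    using img by (auto simp: fin_span_def)
  obtain K where K: "finite K" "S \<inter> {x. f x = 0} \<subseteq> vs1.span K"
    using ker by (auto simp: fin_span_def)
  obtain B where B: "B \<subseteq> f ` S" "vs2.independent B" "f ` S \<subseteq> vs2.span B"
    using vs2.maximal_independent_subset by blast
  have "B \<subseteq> vs2.span C" using B C by blast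
  then have "finite B"
    using vs2.independent_span_bound[OF C(1) B(2)] by blast
  then obtain B' where B': "B' \<subseteq> S" "finite B'" "B = f ` B'"
    using B(1) by (meson finite_subset_image)
  have "x \<in> vs1.span (B' \<union> K)" if x: "x \<in> S" for x
  proof -
    have "f x \<in> f ` vs1.span B'"
      using B(3) x B'(3) f.span_image by auto
    then obtain y where y: "y \<in> vs1.span B'" "f x = f y" by blast
    have "y \<in> S" using y(1) B'(1) S by (meson vs1.span_minimal subsetD)
    then have "x - y \<in> S \<inter> {x. f x = 0}"
      using x S y(2) by (simp add: vs1.subspace_diff f.diff)
    then have "x - y \<in> vs1.span (B' \<union> K)" "y \<in> vs1.span (B' \<union> K)"
      using K(2) y(1) by (meson vs1.span_mono subsetD sup.cobounded1 sup.cobounded2)+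
    then have "(x - y) + y \<in> vs1.span (B' \<union> K)" by (rule vs1.span_add)
    then show ?thesis by simp
  qed
  then show ?thesis unfolding fin_span_def using B'(2) K(1)
    by (intro exI[of _ "B' \<union> K"]) auto
qed

end

lemma (in vector_space) fin_span_zero: "fin_span scale {0}"
  unfolding fin_span_def by (intro exI[of _ "{}"]) auto

section \<open>Polynomials in a linear operator\<close>

text \<open>The element \<open>h(T) v\<close>, by Horner's scheme.\<close>

definition poly_op :: "('f::comm_ring_1 \<Rightarrow> 'v \<Rightarrow> 'v) \<Rightarrow> ('v \<Rightarrow> 'v) \<Rightarrow> 'f poly \<Rightarrow> 'v \<Rightarrow> 'v::ab_group_add" where
  "poly_op s T h v = fold_coeffs (\<lambda>c x. s c v + T x) h 0"

locale operator = vector_space s + Vector_Spaces.linear s s T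
  for s :: "'f::field \<Rightarrow> 'v::ab_group_add \<Rightarrow> 'v" and T :: "'v \<Rightarrow> 'v"
begin

lemma poly_op_0 [simp]: "poly_op s T 0 v = 0"
  by (simp add: poly_op_def)

lemma poly_op_pCons: "poly_op s T (pCons c h) v = s c v + T (poly_op s T h v)"
  by (cases "c = 0 \<and> h = 0") (auto simp: poly_op_def zero)

lemma poly_op_1 [simp]: "poly_op s T 1 v = v"
  by (simp add: one_pCons poly_op_pCons zero)

lemma poly_op_add_left: "poly_op s T (g + h) v = poly_op s T g v + poly_op s T h v"
proof (induction g h rule: poly_induct2)
  case (pCons a p b q)
  then show ?case by (simp add: poly_op_pCons add scale_left_distrib algebra_simps)
qed simp

lemma poly_op_smult: "poly_op s T (smult c h) v = s c (poly_op s T h v)"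
  by (induction h) (simp_all add: poly_op_pCons scale scale_right_distrib)

lemma poly_op_mult: "poly_op s T (g * h) v = poly_op s T g (poly_op s T h v)"
  by (induction g) (simp_all add: poly_op_pCons poly_op_add_left poly_op_smult mult_pCons_left)

lemma poly_op_intertwine:
  assumes f: "Vector_Spaces.linear s s f" and eq: "\<And>x. f (T x) = U (f x)"
    and U: "Vector_Spaces.linear s s U"
  shows "f (poly_op s T h v) = poly_op s U h (f v)"
proof -
  interpret f: Vector_Spaces.linear s s f by (rule f)
  interpret U: operator s U by (intro operator.intro vector_space_axioms U)
  show ?thesis
    by (induction h) (simp_all add: poly_op_pCons U.poly_op_pCons f.add f.scale f.zero eq)
qed

lemma poly_op_add: "poly_op s T h (x + y) = poly_op s T h x + poly_op s T h y"
  by (induction h) (simp_all add: poly_op_pCons add scale_right_distrib)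

lemma poly_op_zero [simp]: "poly_op s T h 0 = 0"
  by (induction h) (simp_all add: poly_op_pCons zero)

lemma poly_op_scale: "poly_op s T h (s r x) = s r (poly_op s T h x)"
  by (induction h) (simp_all add: poly_op_pCons scale scale_right_distrib mult.commute)

lemma poly_op_eigen:
  assumes "T u = s b u"
  shows "poly_op s T h u = s (poly h b) u"
  by (induction h) (simp_all add: poly_op_pCons scale assms scale_left_distrib mult.commute)

lemma poly_op_closed:
  assumes "subspace W" "\<And>x. x \<in> W \<Longrightarrow> T x \<in> W" "v \<in> W"
  shows "poly_op s T h v \<in> W"
  by (induction h)
    (use assms in \<open>auto simp: poly_op_pCons subspace_0 intro!: subspace_add subspace_scale\<close>)

end

text \<open>Linear factors are split off \<open>h\<close> one at a time. If the cofactor still kills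
  \<open>w\<close>, it replaces \<open>h\<close>; otherwise it sends \<open>w\<close> to an
  eigenvector.\<close>

lemma (in operator) poly_op_eigenvector:
  fixes h :: "'f poly"
  assumes ac: "\<And>g :: 'f poly. degree g > 0 \<Longrightarrow> \<exists>z. poly g z = 0"
    and "h \<noteq> 0" "poly_op s T h w = 0" "w \<noteq> 0"
  shows "\<exists>u b. u \<noteq> 0 \<and> T u = s b u \<and> poly h b = 0"
  using assms(2,3)
proof (induction "degree h" arbitrary: h)
  case 0
  then obtain c where "h = [:c:]" using degree_eq_zeroE by metis
  then show ?case using 0 assms(4) by (auto simp: poly_op_pCons zero)
next
  case (Suc n)
  obtain z where z: "poly h z = 0" using ac[of h] Suc(2) by auto
  then obtain g where g: "h = [:-z, 1:] * g" by (auto simp: poly_eq_0_iff_dvd elim: dvdE)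
  show ?case
  proof (cases "poly_op s T g w = 0")
    case True
    have "g \<noteq> 0" using Suc g by auto
    then have "degree h = Suc (degree g)" unfolding g by (subst degree_mult_eq) auto
    then show ?thesis using Suc(1)[of g] Suc(2) True \<open>g \<noteq> 0\<close> g by auto
  next
    case False
    have "poly_op s T [:-z, 1:] (poly_op s T g w) = 0"
      using Suc.prems(2) unfolding g poly_op_mult .
    then have "T (poly_op s T g w) = s z (poly_op s T g w)"
      by (simp add: poly_op_pCons zero)
    then show ?thesis using False z by blast
  qed
qed

lemma vector_space_poly: "vector_space (smult :: 'f::field \<Rightarrow> 'f poly \<Rightarrow> 'f poly)"
  by unfold_locales (auto simp: smult_add_right smult_add_left)

lemma not_fin_span_poly: "\<not> fin_span smult (UNIV :: 'f::field poly set)"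
proof
  interpret P: vector_space "smult :: 'f \<Rightarrow> 'f poly \<Rightarrow> 'f poly" by (rule vector_space_poly)
  assume "fin_span smult (UNIV :: 'f poly set)"
  then obtain B where B: "finite B" "(UNIV :: 'f poly set) \<subseteq> P.span B"
    by (auto simp: fin_span_def)
  define D where "D = Max (insert 0 (degree ` B))"
  have "P.span B \<subseteq> {p. degree p \<le> D}"
  proof (rule P.span_minimal)
    show "B \<subseteq> {p. degree p \<le> D}" using B(1) by (auto simp: D_def)
    show "P.subspace {p. degree p \<le> D}"
      unfolding P.subspace_def by (auto intro: degree_add_le order.trans[OF degree_smult_le])
  qed
  then have "degree (monom (1::'f) (Suc D)) \<le> D" using B by auto
  then show False by (simp add: degree_monom_eq)
qed

text \<open>The map \<open>h \<mapsto> poly_op s T h v\<close> goes from a space of infinite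
  dimension into one of finite dimension, so its kernel is nonzero.\<close>

lemma (in operator) fin_span_annihilator:
  assumes F: "fin_span s F" and "\<And>h. poly_op s T h v \<in> F"
  shows "\<exists>h. h \<noteq> 0 \<and> poly_op s T h v = 0"
proof (rule ccontr)
  assume neg: "\<not> ?thesis"
  interpret P: vector_space "smult :: 'f \<Rightarrow> 'f poly \<Rightarrow> 'f poly" by (rule vector_space_poly)
  interpret pair: vector_space_pair "smult :: 'f \<Rightarrow> 'f poly \<Rightarrow> 'f poly" s ..
  have lin: "Vector_Spaces.linear smult s (\<lambda>h. poly_op s T h v)"
    by unfold_locales (auto simp: poly_op_add_left poly_op_smult)
  have "fin_span smult (UNIV :: 'f poly set)"
  proof (rule pair.fin_span_of_kernel[OF lin])
    show "fin_span s (range (\<lambda>h. poly_op s T h v))"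
      by (rule fin_span_subset[OF F]) (use assms(2) in auto)
    have "UNIV \<inter> {h. poly_op s T h v = 0} = {0}" using neg by auto
    then show "fin_span smult (UNIV \<inter> {h. poly_op s T h v = 0})"
      using P.fin_span_zero by simp
  qed auto
  then show False using not_fin_span_poly by blast
qed

section \<open>Finitely generated modules over polynomials in one variable\<close>

locale poly_module = module scale
  for scale :: "'f::field poly \<Rightarrow> 'v::ab_group_add \<Rightarrow> 'v"
begin

lemma vector_space_const: "vector_space (\<lambda>c. scale [:c:])"
  by unfold_locales (simp_all add: scale_right_distrib mult.commute flip: scale_left_distrib one_pCons)

sublocale V: vector_space "\<lambda>c. scale [:c:]"
  by (rule vector_space_const)

abbreviation fin_dim :: "'v set \<Rightarrow> bool" where
  "fin_dim \<equiv> fin_span (\<lambda>c. scale [:c:])"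

lemma subspace_annihilated: "subspace {v. scale q v = 0}"
proof -
  have "scale q (scale c x) = scale c (scale q x)" for c x by (simp add: mult.commute)
  then show ?thesis by (auto simp: subspace_def scale_right_distrib simp del: scale_scale)
qed

text \<open>The Noetherian property, by induction on the number of generators and division with
  remainder.\<close>

lemma submodule_finitely_generated:
  assumes "finite G" "subspace N" "N \<subseteq> span G"
  shows "\<exists>S. finite S \<and> span S = N"
  using assms
proof (induction G arbitrary: N rule: finite_induct)
  case empty
  then have "span {} = N" using subspace_0 by auto
  then show ?case by blast
next
  case (insert g G)
  \<comment> \<open>The ideal of coefficients of \<open>g\<close> in elements of \<open>N\<close>,
    modulo \<open>span G\<close>. A nonzero element of least degree lifts to some \<open>n0\<close>,
    which generates \<open>N\<close> together with \<open>N \<inter> span G\<close>.\<close>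
  define I where "I = {q. \<exists>n\<in>N. n - scale q g \<in> span G}"
  have N'sub: "subspace (N \<inter> span G)"
    using insert.prems(1) by (simp add: subspace_inter)
  obtain S' where S': "finite S'" "span S' = N \<inter> span G"
    using insert.IH[OF N'sub] by auto
  show ?case
  proof (cases "\<exists>q\<in>I. q \<noteq> 0")
    case False
    have "n \<in> span G" if n: "n \<in> N" for n
    proof -
      obtain q where q: "n - scale q g \<in> span G"
        using insert.prems(2) n by (meson span_breakdown_eq subsetD)
      then have "q = 0" using False n by (auto simp: I_def)
      then show ?thesis using q by simp
    qed
    then have "N \<inter> span G = N" by auto
    then show ?thesis using S' by auto
  next
    case True
    then obtain r where r: "r \<in> I" "r \<noteq> 0" and min: "\<And>q. q \<in> I \<Longrightarrow> q \<noteq> 0 \<Longrightarrow> degree r \<le> degree q"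
      using ex_has_least_nat[of "\<lambda>q. q \<in> I \<and> q \<noteq> 0" _ degree] by metis
    then obtain n0 where n0: "n0 \<in> N" "n0 - scale r g \<in> span G" by (auto simp: I_def)
    have "n \<in> span (insert n0 S')" if n: "n \<in> N" for n
    proof -
      obtain q where q: "n - scale q g \<in> span G"
        using insert.prems(2) n by (meson span_breakdown_eq subsetD)
      let ?n = "n - scale (q div r) n0"
      have nN: "?n \<in> N"
        using n n0 insert.prems(1) by (simp add: subspace_diff subspace_scale)
      have "(n - scale q g) - scale (q div r) (n0 - scale r g) \<in> span G"
        by (rule span_diff[OF q span_scale[OF n0(2)]])
      also have "(n - scale q g) - scale (q div r) (n0 - scale r g)
          = ?n - scale (q - q div r * r) g"
        by (simp add: scale_right_diff_distrib scale_left_diff_distrib algebra_simps)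
      finally have *: "?n - scale (q mod r) g \<in> span G"
        by (simp add: minus_div_mult_eq_mod)
      then have "q mod r \<in> I" using nN by (auto simp: I_def)
      then have "q mod r = 0"
        using min[of "q mod r"] degree_mod_less'[OF r(2), of q] by linarith
      then have "?n \<in> span S'" using * nN S' by auto
      then show ?thesis by (auto simp: span_breakdown_eq)
    qed
    moreover have "span (insert n0 S') \<subseteq> N"
      using S' n0 span_superset[of S'] insert.prems(1) by (intro span_minimal) auto
    ultimately show ?thesis using S'(1) by (intro exI[of _ "insert n0 S'"]) auto
  qed
qed

text \<open>The torsion elements form a submodule, which is finitely generated; the product of
  annihilators of its generators kills all of it.\<close>

lemma torsion_annihilator:
  assumes G: "finite G" "span G = UNIV"
  shows "\<exists>q. q \<noteq> 0 \<and> (\<forall>p v. p \<noteq> 0 \<longrightarrow> scale p v = 0 \<longrightarrow> scale q v = 0)"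
proof -
  let ?N = "{v. \<exists>p. p \<noteq> 0 \<and> scale p v = 0}"
  have "subspace ?N"
    unfolding subspace_def
  proof (intro conjI ballI allI)
    show "0 \<in> ?N" by (auto intro: exI[of _ 1])
  next
    fix x y assume "x \<in> ?N" "y \<in> ?N"
    then obtain p q where p: "p \<noteq> 0" "scale p x = 0" and q: "q \<noteq> 0" "scale q y = 0" by blast
    have "scale (p * q) (x + y) = scale q (scale p x) + scale p (scale q y)"
      by (simp add: scale_right_distrib mult.commute)
    then have "scale (p * q) (x + y) = 0" "p * q \<noteq> 0" using p q by simp_all
    then show "x + y \<in> ?N" by blast
  next
    fix c x assume "x \<in> ?N"
    then obtain p where p: "p \<noteq> 0" "scale p x = 0" by blast
    have "scale p (scale c x) = scale c (scale p x)" by (simp add: mult.commute)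
    then show "scale c x \<in> ?N" using p by auto
  qed
  then obtain S where S: "finite S" "span S = ?N"
    using submodule_finitely_generated[of G ?N] G by auto
  then have "\<forall>s\<in>S. \<exists>p. p \<noteq> 0 \<and> scale p s = 0" using span_superset[of S] by auto
  then obtain P where P: "\<And>s. s \<in> S \<Longrightarrow> P s \<noteq> 0 \<and> scale (P s) s = 0" by metis
  define q where "q = prod P S"
  have "span S \<subseteq> {v. scale q v = 0}"
  proof (rule span_minimal)
    show "S \<subseteq> {v. scale q v = 0}"
    proof
      fix s assume s: "s \<in> S"
      then have "scale q s = scale (prod P (S - {s})) (scale (P s) s)"
        using S(1) by (simp add: q_def prod.remove[of S s] mult.commute)
      then show "s \<in> {v. scale q v = 0}" using P[OF s] by simp
    qed
  qed (rule subspace_annihilated)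
  moreover have "q \<noteq> 0" using S(1) P by (auto simp: q_def)
  ultimately show ?thesis using S(2) by blast
qed

text \<open>The kernel of \<open>h\<close> is finitely generated, and on each generator a polynomial
  acts as its remainder modulo \<open>h\<close>, so finitely many powers of the variable
  suffice.\<close>

lemma fin_dim_torsion:
  assumes G: "finite G" "span G = UNIV" and h: "h \<noteq> 0"
  shows "fin_dim {v. scale h v = 0}"
proof -
  obtain S where S: "finite S" "span S = {v. scale h v = 0}"
    using submodule_finitely_generated[OF G(1) subspace_annihilated, of h] G by auto
  define B where "B = (\<Union>s\<in>S. (\<lambda>j. scale (monom 1 j) s) ` {..degree h})"
  have fB: "finite B" using S(1) by (auto simp: B_def)
  have gen: "scale q s \<in> V.span B" if s: "s \<in> S" for q s
  proof -
    have 0: "scale h s = 0" using s S(2) span_superset[of S] by auto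
    have "scale q s = scale (q div h * h + q mod h) s" by simp
    also have "\<dots> = scale (q div h) (scale h s) + scale (q mod h) s"
      by (simp only: scale_left_distrib scale_scale)
    also have "\<dots> = scale (q mod h) s" using 0 by simp
    also have "q mod h = (\<Sum>j\<le>degree h. monom (coeff (q mod h) j) j)"
      using degree_mod_less[OF h, of q] by (intro poly_as_sum_of_monoms'[symmetric]) auto
    also have "scale \<dots> s = (\<Sum>j\<le>degree h. scale [:coeff (q mod h) j:] (scale (monom 1 j) s))"
      by (simp add: scale_sum_left smult_monom)
    also have "\<dots> \<in> V.span B"
      using s by (intro V.span_sum V.span_scale V.span_base) (auto simp: B_def)
    finally show ?thesis .
  qed
  have "v \<in> V.span B" if "v \<in> span S" for v
    using that by (induction rule: span_induct_alt) (auto intro: V.span_add V.span_zero gen)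
  then show ?thesis unfolding fin_span_def using fB S(2) by blast
qed

end

section \<open>Products and commutators\<close>

lemma coeff_mult_lam: "coeff (mult_lam u) n = pCons 0 (coeff u n)"
  by (simp add: mult_lam_def coeff_map_poly)

lemma coeff_mult_mu: "coeff (mult_mu u) n = (case n of 0 \<Rightarrow> 0 | Suc n' \<Rightarrow> coeff u n')"
  by (simp add: mult_mu_def coeff_pCons)

lemma coeff_mult_mu_power_const: "coeff ((mult_mu ^^ k) [:x:]) n = (if n = k then x else 0)"
  by (induction k arbitrary: n) (auto simp: coeff_mult_mu coeff_pCons split: nat.splits)

lemma coeff_mult_lam_power:
  "coeff (coeff ((mult_lam ^^ k) u) n) l = (if k \<le> l then coeff (coeff u n) (l - k) else 0)"
  by (induction k arbitrary: l) (auto simp: coeff_mult_lam coeff_pCons split: nat.splits)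

text \<open>Beyond the degree the inner coefficient is zero, so \<open>act a 0 = 0\<close> makes the
  formula valid for every \<open>n\<close>.\<close>

lemma coeff_lam_mu_act:
  assumes "act a 0 = 0"
  shows "coeff (lam_mu_act act a b m) n = act a (coeff (act b m) n)"
  using assms
  by (simp add: lam_mu_act_def subst_var_def coeff_sum coeff_mult_mu_power_const coeff_eq_0)

lemma coeff_mu_lam_act:
  assumes "act b 0 = 0"
  shows "coeff (coeff (mu_lam_act act b a m) n) l = coeff (act b (coeff (act a m) l)) n"
proof -
  have "coeff (coeff (mu_lam_act act b a m) n) l
      = (\<Sum>k\<le>degree (act a m). if k \<le> l
          then coeff [:coeff (act b (coeff (act a m) k)) n:] (l - k) else 0)"
    by (simp add: mu_lam_act_def subst_var_def coeff_sum coeff_mult_lam_power coeff_map_poly cong: if_cong)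
  also have "\<dots> = (\<Sum>k\<le>degree (act a m). if k = l
          then coeff (act b (coeff (act a m) l)) n else 0)"
    by (intro sum.cong) (auto simp: coeff_pCons split: nat.splits)
  also have "\<dots> = coeff (act b (coeff (act a m) l)) n"
    using assms by (simp add: coeff_eq_0)
  finally show ?thesis .
qed

context poly_module
begin

text \<open>The binomial theorem for (\<lambda> + \<mu>)^k; the induction step is Pascal's
  rule.\<close>

lemma coeff_lam_plus_mu_power:
  "coeff (coeff (((\<lambda>u. mult_lam u + mult_mu u) ^^ k) [:[:y:]:]) n) l
     = (if n + l = k then scale [:of_nat (k choose n):] y else 0)"
proof (induction k arbitrary: n l)
  case 0
  then show ?case by (auto simp: coeff_pCons split: nat.splits simp flip: one_pCons)
next
  case (Suc k)
  have "scale [:of_nat (p + q):] y = scale [:of_nat p:] y + scale [:of_nat q:] y" for p q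
    by (simp flip: scale_left_distrib)
  then show ?case
    by (cases n; cases l) (auto simp: Suc coeff_mult_lam coeff_mult_mu simp flip: one_pCons)
qed

end

context lie_conformal_module
begin

sublocale A: poly_module scale ..

sublocale P: poly_module scaleM ..

lemma act_0_right [simp]: "act a 0 = 0"
  using act_add_right[of a 0 0] by simp

lemma act_0_left [simp]: "act 0 v = 0"
  using act_add_left[of 0 0 v] by simp

lemma coeff_bracket_act:
  "coeff (coeff (bracket_act br act a b m) n) l
     = (\<Sum>j\<le>l. scaleM [:of_nat ((n + (l - j)) choose n):]
          (coeff (act (coeff (br a b) j) m) (n + (l - j))))"
proof -
  let ?c = "\<lambda>j. coeff (br a b) j"
  \<comment> \<open>The factor \<lambda>^j contributes nothing to \<lambda>^l when j > l. This
    default 0 lets the range change from the degree of \<open>br a b\<close> to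
    \<open>l\<close>.\<close>
  let ?f = "\<lambda>j. if j \<le> l then scaleM [:of_nat ((n + (l - j)) choose n):]
          (coeff (act (?c j) m) (n + (l - j))) else 0"
  have "coeff (coeff (subst_var (\<lambda>y. [:[:y:]:]) (\<lambda>u. mult_lam u + mult_mu u) w) n) l'
      = scaleM [:of_nat ((n + l') choose n):] (coeff w (n + l'))" for w l'
    by (simp add: subst_var_def coeff_sum P.coeff_lam_plus_mu_power coeff_eq_0)
  then have "coeff (coeff (bracket_act br act a b m) n) l = (\<Sum>j\<le>degree (br a b). ?f j)"
    by (simp add: bracket_act_def subst_var_def[of _ mult_lam] coeff_sum coeff_mult_lam_power cong: if_cong)
  also have "\<dots> = (\<Sum>j\<le>max l (degree (br a b)). ?f j)"
    by (intro sum.mono_neutral_left) (auto simp: coeff_eq_0)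
  also have "\<dots> = (\<Sum>j\<le>l. ?f j)"
    by (intro sum.mono_neutral_right) auto
  finally show ?thesis by simp
qed

lemma coeff_commutator:
  "coeff (act a (coeff (act b m) n)) l
     = (\<Sum>j\<le>l. scaleM [:of_nat ((n + (l - j)) choose n):]
          (coeff (act (coeff (br a b) j) m) (n + (l - j))))
       + coeff (act b (coeff (act a m) l)) n"
  using arg_cong[OF act_jacobi[of a b m], of "\<lambda>u. coeff (coeff u n) l"]
  by (simp add: coeff_lam_mu_act coeff_mu_lam_act coeff_bracket_act)

text \<open>The products \<open>a\<^sub>(\<^sub>n\<^sub>) v\<close>, given by \<open>a\<^sub>\<lambda> v = \<Sum>n. \<lambda>^n a\<^sub>(\<^sub>n\<^sub>) v / n!\<close>.\<close>

definition pr :: "'a \<Rightarrow> nat \<Rightarrow> 'm \<Rightarrow> 'm" where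
  "pr a n v = scaleM [:fact n:] (coeff (act a v) n)"

definition prA :: "'a \<Rightarrow> nat \<Rightarrow> 'a \<Rightarrow> 'a" where
  "prA a n b = scale [:fact n:] (coeff (br a b) n)"

lemma pr_add_left: "pr (a + b) n v = pr a n v + pr b n v"
  by (simp add: pr_def act_add_left M.scale_right_distrib)

lemma pr_scale_left: "pr (scale [:c:] a) n v = scaleM [:c:] (pr a n v)"
  by (simp add: pr_def act_scale_left coeff_map_poly mult.commute)

lemma pr_0_left [simp]: "pr 0 n v = 0"
  by (simp add: pr_def)

lemma pr_linear: "Vector_Spaces.linear (\<lambda>c. scaleM [:c:]) (\<lambda>c. scaleM [:c:]) (pr a n)"
  by unfold_locales
    (simp_all add: pr_def act_add_right act_scale_right coeff_map_poly M.scale_right_distrib mult.commute)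

lemma pr_add: "pr a n (v + w) = pr a n v + pr a n w"
  by (simp add: pr_def act_add_right M.scale_right_distrib)

lemma pr_scale: "pr a n (scaleM [:c:] v) = scaleM [:c:] (pr a n v)"
  by (simp add: pr_def act_scale_right coeff_map_poly mult.commute)

lemma pr_0 [simp]: "pr a n 0 = 0"
  by (simp add: pr_def)

lemma pr_minus: "pr a n (- v) = - pr a n v"
  using pr_add[of a n v "- v"] by (simp add: eq_neg_iff_add_eq_0 add.commute)

lemma pr_diff: "pr a n (v - w) = pr a n v - pr a n w"
  using pr_add[of a n v "- w"] by (simp add: pr_minus)

text \<open>At n = 0 the truncated index \<open>n - 1\<close> is harmless because its coefficient
  \<open>of_nat n\<close> vanishes; \<open>pr_partial\<close> and \<open>commutator_primary\<close>
  rely on the same convention.\<close>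

lemma pr_partial_left: "pr (partial scale a) n v = - scaleM [:of_nat n:] (pr a (n - 1) v)"
  by (cases n) (simp_all add: pr_def act_partial_left mult_var_def coeff_pCons mult.commute)

lemma pr_partial: "pr a n (partial scaleM v)
    = partial scaleM (pr a n v) + scaleM [:of_nat n:] (pr a (n - 1) v)"
  by (cases n) (simp_all add: pr_def act_partial_right mult_var_def coeff_pCons coeff_map_poly
      M.scale_right_distrib mult.commute)

lemma pr_eq_0_iff: "pr a n v = 0 \<longleftrightarrow> coeff (act a v) n = 0"
  unfolding pr_def by (simp only: P.V.scale_eq_0_iff) simp

lemma act_eq_0_iff: "act a v = 0 \<longleftrightarrow> (\<forall>n. pr a n v = 0)"
  by (simp add: pr_eq_0_iff poly_eq_iff)

lemma pr_eventually_0: "\<exists>N. \<forall>n\<ge>N. pr a n v = 0"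
  by (auto simp: pr_eq_0_iff coeff_eq_0 intro!: exI[of _ "Suc (degree (act a v))"])

lemma fact_choose_commutator:
  assumes "j \<le> l"
  shows "fact l * fact n * of_nat ((n + (l - j)) choose n)
    = (of_nat (l choose j) * fact j * fact (n + (l - j)) :: complex)"
proof -
  have "of_nat (l choose j) = (fact l / (fact j * fact (l - j)) :: complex)"
    using assms by (rule binomial_fact)
  moreover have "of_nat ((n + (l - j)) choose n)
      = (fact (n + (l - j)) / (fact n * fact (l - j)) :: complex)"
    using binomial_fact[of n "n + (l - j)", where 'a = complex] by simp
  ultimately show ?thesis by simp
qed

text \<open>The Jacobi identity at \<lambda>^l \<mu>^n; normalising the products by factorials
  leaves only the binomials \<open>l choose j\<close>.\<close>

lemma commutator:
  "pr a l (pr b n v) = pr b n (pr a l v)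
     + (\<Sum>j\<le>l. scaleM [:of_nat (l choose j):] (pr (prA a j b) (n + (l - j)) v))"
proof -
  have 1: "pr a l (pr b n v) = scaleM [:fact l * fact n:] (coeff (act a (coeff (act b v) n)) l)" for a b l n
    by (simp add: pr_def act_scale_right coeff_map_poly mult.commute)
  have 2: "pr b n (pr a l v) = scaleM [:fact l * fact n:] (coeff (act b (coeff (act a v) l)) n)"
    by (subst 1) (simp only: mult.commute)
  have "pr a l (pr b n v)
      = (\<Sum>j\<le>l. scaleM [:fact l * fact n:] (scaleM [:of_nat ((n + (l - j)) choose n):]
          (coeff (act (coeff (br a b) j) v) (n + (l - j))))) + pr b n (pr a l v)"
    unfolding 1[of a l b n] 2
    by (subst coeff_commutator) (simp only: M.scale_right_distrib M.scale_sum_right)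
  also have "(\<Sum>j\<le>l. scaleM [:fact l * fact n:] (scaleM [:of_nat ((n + (l - j)) choose n):]
          (coeff (act (coeff (br a b) j) v) (n + (l - j)))))
      = (\<Sum>j\<le>l. scaleM [:of_nat (l choose j):] (pr (prA a j b) (n + (l - j)) v))"
  proof (intro sum.cong refl)
    fix j assume "j \<in> {..l}"
    then have j: "j \<le> l" by simp
    show "scaleM [:fact l * fact n:] (scaleM [:of_nat ((n + (l - j)) choose n):]
          (coeff (act (coeff (br a b) j) v) (n + (l - j))))
      = scaleM [:of_nat (l choose j):] (pr (prA a j b) (n + (l - j)) v)"
      using fact_choose_commutator[OF j, of n]
      by (simp add: pr_def prA_def act_scale_left coeff_map_poly P.V.scale_scale mult.assoc
          del: M.scale_scale)
  qed
  finally show ?thesis by (simp add: add.commute)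
qed

end

section \<open>The Virasoro element\<close>

text \<open>This makes all results on modules available for the bracket itself.\<close>

lemma (in lie_conformal_algebra) adjoint_module: "lie_conformal_module scale br scale br"
  by unfold_locales
    (rule br_add_left br_add_right br_scale_left br_scale_right br_partial_left
      br_partial_right br_jacobi)+

context lie_conformal_module
begin

text \<open>This says \<open>[a\<^sub>\<lambda> b] = (\<partial> + \<alpha> + \<Delta>\<lambda>) b\<close>.\<close>

definition primary :: "'a \<Rightarrow> complex \<Rightarrow> complex \<Rightarrow> 'a \<Rightarrow> bool" where
  "primary a \<alpha> \<Delta> b \<longleftrightarrow> prA a 0 b = scale [:\<alpha>, 1:] b \<and> prA a 1 b = scale [:\<Delta>:] b \<and>
     (\<forall>j\<ge>2. prA a j b = 0)"

text \<open>Only j = 0 and j = 1 survive in \<open>commutator\<close>. The \<partial> inside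
  \<open>prA a 0 b\<close> contributes -(p + n), and j = 1 contributes p \<Delta>.\<close>

lemma commutator_primary:
  assumes "primary a \<alpha> \<Delta> b"
  shows "pr a p (pr b n v) = pr b n (pr a p v) + scaleM [:\<alpha>:] (pr b (p + n) v)
     + scaleM [:of_nat p * (\<Delta> - 1) - of_nat n:] (pr b (p + n - 1) v)"
proof -
  let ?f = "\<lambda>j. scaleM [:of_nat (p choose j):] (pr (prA a j b) (n + (p - j)) v)"
  have b0: "prA a 0 b = scale [:\<alpha>:] b + partial scale b"
    using assms by (simp add: primary_def flip: scale_left_distrib)
  have f0: "?f 0 = scaleM [:\<alpha>:] (pr b (p + n) v) - scaleM [:of_nat (p + n):] (pr b (p + n - 1) v)"
    by (simp add: b0 pr_add_left pr_scale_left pr_partial_left add.commute)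
  have "(\<Sum>j\<le>p. ?f j) = ?f 0 + scaleM [:of_nat p * \<Delta>:] (pr b (p + n - 1) v)"
  proof (cases p)
    case 0
    then show ?thesis by simp
  next
    case (Suc p')
    have "(\<Sum>j\<le>p. ?f j) = (\<Sum>j\<in>{0, 1}. ?f j)"
      using Suc assms by (intro sum.mono_neutral_right) (auto simp: primary_def)
    also have "\<dots> = ?f 0 + ?f 1" by simp
    also have "?f 1 = scaleM [:of_nat p * \<Delta>:] (pr b (p + n - 1) v)"
      using Suc assms by (simp add: primary_def pr_scale_left add.commute)
    finally show ?thesis .
  qed
  moreover have "scaleM [:of_nat p * (\<Delta> - 1) - of_nat n:] w
      = scaleM [:of_nat p * \<Delta>:] w - scaleM [:of_nat (p + n):] w" for w
    by (simp add: algebra_simps flip: M.scale_left_diff_distrib)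
  ultimately show ?thesis unfolding commutator[of a p b n v] f0 by (simp add: algebra_simps)
qed

section \<open>Products on \<partial>-multiples and Virasoro modules of rank one\<close>

lemma pr_scaleM_pCons: "pr a n (scaleM (pCons c q) v)
   = scaleM [:c:] (pr a n v) + partial scaleM (pr a n (scaleM q v))
     + scaleM [:of_nat n:] (pr a (n - 1) (scaleM q v))"
proof -
  have "scaleM (pCons c q) v = scaleM [:c:] v + partial scaleM (scaleM q v)"
    by (simp flip: M.scale_left_distrib)
  then show ?thesis by (simp only: pr_add pr_scale pr_partial add.assoc)
qed

text \<open>Moving \<partial> past \<open>pr a n\<close> only adds a multiple of
  \<open>pr a (n - 1)\<close>, so the common kernel is stable. Hence vanishing can be tested on
  generators.\<close>

lemma subspace_annihilator: "M.subspace {v. \<forall>n. pr a n v = 0}"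
proof -
  have "pr a n (scaleM q v) = 0" if "\<forall>n. pr a n v = 0" for q n v
    using that by (induction q arbitrary: n) (simp_all add: pr_scaleM_pCons)
  then show ?thesis by (auto simp: M.subspace_def pr_add)
qed

lemma pr_0_scaleM: "pr a 0 (scaleM q v) = scaleM q (pr a 0 v)"
  by (induction q) (simp_all add: pr_scaleM_pCons flip: M.scale_left_distrib)

text \<open>Each degree in \<partial> raises the top index by one and multiplies the top product by
  a positive integer, so nothing cancels there.\<close>

lemma pr_scaleM_top:
  assumes "\<And>n. n > N \<Longrightarrow> pr a n v = 0"
  shows "(\<forall>n > N + degree q. pr a n (scaleM q v) = 0) \<and>
    (q \<noteq> 0 \<longrightarrow> (\<exists>c. c \<noteq> 0 \<and> pr a (N + degree q) (scaleM q v) = scaleM [:c:] (pr a N v)))"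
proof (induction q)
  case 0
  then show ?case by simp
next
  case (pCons c q)
  show ?case
  proof (cases "q = 0")
    case True
    then show ?thesis using assms pCons(1) by (auto simp: pr_scale)
  next
    case False
    then obtain d where d: "d \<noteq> 0" "pr a (N + degree q) (scaleM q v) = scaleM [:d:] (pr a N v)"
      using pCons(2) by blast
    have "pr a (N + Suc (degree q)) (scaleM (pCons c q) v)
        = scaleM [:of_nat (N + Suc (degree q)) * d:] (pr a N v)"
      using pCons(2) assms d(2) by (simp add: pr_scaleM_pCons mult.commute)
    moreover have "of_nat (N + Suc (degree q)) * d \<noteq> 0"
      using d(1) by (simp del: of_nat_add of_nat_Suc)
    moreover have "pr a n (scaleM (pCons c q) v) = 0" if "n > N + Suc (degree q)" for n
      using that pCons(2) assms by (simp add: pr_scaleM_pCons)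
    ultimately show ?thesis using False
      by (intro conjI impI allI exI[of _ "of_nat (N + Suc (degree q)) * d"]) simp_all
  qed
qed

lemma pr_scaleM_bottom:
  assumes "\<And>k. k < m \<Longrightarrow> pr a k v = 0"
  shows "(\<forall>k<m. pr a k (scaleM q v) = 0) \<and> pr a m (scaleM q v) = scaleM q (pr a m v) \<and>
    pr a (Suc m) (scaleM q v)
      = scaleM q (pr a (Suc m) v) + scaleM (smult (of_nat (Suc m)) (pderiv q)) (pr a m v)"
proof (induction q)
  case 0
  then show ?case by simp
next
  case (pCons c q)
  have 1: "pr a k (scaleM (pCons c q) v) = 0" if "k < m" for k
    using that pCons(2) assms by (simp add: pr_scaleM_pCons)
  have "scaleM [:of_nat m:] (pr a (m - 1) (scaleM q v)) = 0"
    using pCons(2) by (cases m) auto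
  then have 2: "pr a m (scaleM (pCons c q) v) = scaleM (pCons c q) (pr a m v)"
    using pCons(2) by (simp add: pr_scaleM_pCons flip: M.scale_left_distrib)
  have "pr a (Suc m) (scaleM (pCons c q) v)
     = (scaleM [:c:] (pr a (Suc m) v) + scaleM ([:0, 1:] * q) (pr a (Suc m) v))
       + (scaleM ([:0, 1:] * smult (of_nat (Suc m)) (pderiv q)) (pr a m v)
       + scaleM ([:of_nat (Suc m):] * q) (pr a m v))"
    using pCons(2) by (simp add: pr_scaleM_pCons M.scale_right_distrib add.assoc del: of_nat_Suc mult_smult_right)
  also have "\<dots> = scaleM (pCons c q) (pr a (Suc m) v)
      + scaleM (smult (of_nat (Suc m)) (pderiv (pCons c q))) (pr a m v)"
    by (simp add: pderiv_pCons smult_add_right add.commute del: of_nat_Suc flip: M.scale_left_distrib)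
  finally show ?case using 1 2 by blast
qed

text \<open>The lowest nonzero product determines \<open>P 0\<close> up to a constant; the highest
  one forces the other \<open>P k\<close> to be constant and excludes indices above 1.\<close>

lemma virasoro_rank_one:
  assumes vir: "primary a 0 2 a"
    and free: "\<And>q. scaleM q v = 0 \<Longrightarrow> q = 0"
    and rank: "\<And>n. \<exists>q. pr a n v = scaleM q v"
    and nz: "act a v \<noteq> 0"
  shows "\<exists>\<alpha> \<Delta>. pr a 0 v = scaleM [:\<alpha>, 1:] v \<and> pr a 1 v = scaleM [:\<Delta>:] v \<and> (\<forall>n\<ge>2. pr a n v = 0)"
proof -
  have free': "p = q" if "scaleM p v = scaleM q v" for p q
    using free[of "p - q"] that by (simp add: M.scale_left_diff_distrib)
  obtain P where P: "\<And>n. pr a n v = scaleM (P n) v" using rank by metis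
  have P0: "pr a n v = 0 \<longleftrightarrow> P n = 0" for n using P[of n] free[of "P n"] by auto
  have comm: "pr a p (pr a n v) = pr a n (pr a p v)
      + scaleM [:of_nat p - of_nat n:] (pr a (p + n - 1) v)" for p n
    using commutator_primary[OF vir, of p n v] by simp
  obtain n1 where n1: "pr a n1 v \<noteq> 0" using nz by (auto simp: act_eq_0_iff)
  define m where "m = (LEAST n. pr a n v \<noteq> 0)"
  have m: "pr a m v \<noteq> 0" "\<And>k. k < m \<Longrightarrow> pr a k v = 0"
    unfolding m_def using LeastI[of "\<lambda>n. pr a n v \<noteq> 0", OF n1] not_less_Least by blast+
  \<comment> \<open>Composing the products 0 and \<open>Suc m\<close> in both orders, the commutator
    relation leaves ((P 0)' - 1) P m = 0.\<close>
  have "pr a 0 (pr a (Suc m) v) = scaleM (P (Suc m) * P 0) v"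
    by (simp only: P pr_0_scaleM M.scale_scale)
  moreover have "pr a (Suc m) (pr a 0 v)
      = scaleM (P 0 * P (Suc m) + smult (of_nat (Suc m)) (pderiv (P 0)) * P m) v"
    using pr_scaleM_bottom[of m a v "P 0"] m(2)
    by (simp only: P M.scale_scale M.scale_left_distrib)
  moreover have "scaleM [:of_nat 0 - of_nat (Suc m):] (pr a (0 + Suc m - 1) v)
      = - scaleM ([:of_nat (Suc m):] * P m) v"
    by (simp add: P del: of_nat_Suc)
  ultimately have "scaleM (P (Suc m) * P 0) v = scaleM (P 0 * P (Suc m)
      + smult (of_nat (Suc m)) (pderiv (P 0)) * P m - [:of_nat (Suc m):] * P m) v"
    using comm[of 0 "Suc m"] by (simp only: M.scale_left_diff_distrib) simp
  then have "P (Suc m) * P 0 = P 0 * P (Suc m)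
      + smult (of_nat (Suc m)) (pderiv (P 0)) * P m - [:of_nat (Suc m):] * P m"
    by (rule free')
  then have "smult (of_nat (Suc m)) ((pderiv (P 0) - 1) * P m) = 0"
    by (simp add: algebra_simps smult_diff_right del: of_nat_Suc)
  then have "pderiv (P 0) = 1" using m(1) P0 by (simp del: of_nat_Suc)
  then have "pderiv (P 0 - [:0, 1:]) = 0" by (simp add: pderiv_diff pderiv_pCons)
  then obtain \<alpha> where "P 0 - [:0, 1:] = [:\<alpha>:]"
    by (metis pderiv_eq_0_iff degree_eq_zeroE)
  then have \<alpha>: "P 0 = [:\<alpha>, 1:]" by (simp add: algebra_simps)
  obtain B where B: "\<And>n. n \<ge> B \<Longrightarrow> pr a n v = 0" using pr_eventually_0 by blast
  define N where "N = (GREATEST n. pr a n v \<noteq> 0)"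
  have N: "pr a N v \<noteq> 0" "n > N \<Longrightarrow> pr a n v = 0" for n
    using GreatestI_nat[of "\<lambda>n. pr a n v \<noteq> 0" n1 B] n1 B Greatest_le_nat[of "\<lambda>n. pr a n v \<noteq> 0" n B]
    unfolding N_def by (auto simp: not_le) (meson leD nle_le)+
  \<comment> \<open>A positive degree d of \<open>P k\<close> would make product N + d of
    \<open>pr a k v\<close> nonzero, whereas the commutator moves it to indices above
    \<open>N\<close>, where all products of \<open>v\<close> vanish.\<close>
  have const: "degree (P k) = 0" if "k \<ge> 1" for k
  proof (rule ccontr)
    assume d: "degree (P k) \<noteq> 0"
    then have "P k \<noteq> 0" by auto
    then obtain c where c: "c \<noteq> 0" "pr a (N + degree (P k)) (scaleM (P k) v) = scaleM [:c:] (pr a N v)"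
      using pr_scaleM_top[of N a v "P k"] N(2) by blast
    have "pr a (N + degree (P k)) (pr a k v) = 0"
      using comm[of "N + degree (P k)" k] N(2) d that by simp
    then show False using c N(1) by (simp add: P[of k])
  qed
  \<comment> \<open>If N \<ge> 2, the constants \<open>P 1\<close> and \<open>P N\<close> make the
    two products commute on \<open>v\<close>, although their commutator is N - 1 times the top
    product.\<close>
  have "N < 2"
  proof (rule ccontr)
    assume "\<not> N < 2"
    then have N2: "N \<ge> 2" by simp
    obtain x y where "P 1 = [:x:]" "P N = [:y:]"
      using const[of 1] const[of N] N2 by (meson degree_eq_zeroE le_trans one_le_numeral order.refl)
    then have "scaleM [:of_nat N - of_nat 1:] (pr a N v) = 0"
      using comm[of N 1] P[of 1] P[of N] by (simp add: pr_scale mult.commute)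
    then show False using N2 N(1) by (simp only: P.V.scale_eq_0_iff) auto
  qed
  moreover obtain \<Delta> where "P 1 = [:\<Delta>:]" using const[of 1] by (auto elim: degree_eq_zeroE)
  ultimately show ?thesis using P \<alpha> N(2)
    by (intro exI[of _ \<alpha>] exI[of _ \<Delta>]) (auto simp del: One_nat_def)
qed

end

section \<open>The generators of the graded algebra and their weights\<close>

lemma free_graded_by_independent:
  fixes scale :: "complex poly \<Rightarrow> 'b::ab_group_add \<Rightarrow> 'b"
  assumes "module scale" and free: "free_graded_by scale L" and "finite I"
    and sum0: "(\<Sum>i\<in>I. scale (q i) (L i)) = 0" and "i \<in> I"
  shows "q i = 0"
proof -
  interpret module scale by fact
  \<comment> \<open>Extended by zero, the family becomes a decomposition of 0, which uniqueness
    identifies with the zero family.\<close>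
  define y where "y = (\<lambda>i. if i \<in> I then scale (q i) (L i) else 0)"
  have "{i. y i \<noteq> 0} \<subseteq> I" by (auto simp: y_def)
  then have fin: "finite {i. y i \<noteq> 0}" using \<open>finite I\<close> finite_subset by blast
  have "(\<Sum>i | y i \<noteq> 0. y i) = (\<Sum>i\<in>I. y i)"
    using \<open>finite I\<close> by (intro sum.mono_neutral_left) (auto simp: y_def)
  also have "\<dots> = 0" using sum0 by (simp add: y_def cong: sum.cong)
  finally have y0: "0 = (\<Sum>i | y i \<noteq> 0. y i)" by simp
  have zero: "0 \<in> range (\<lambda>q. scale q (L j))" for j
    by (rule range_eqI[of _ _ 0]) simp
  have range_y: "\<forall>j. y j \<in> range (\<lambda>q. scale q (L j))" using zero by (auto simp: y_def)
  define D where "D z \<longleftrightarrow> (\<forall>j. z j \<in> range (\<lambda>q. scale q (L j))) \<and> finite {j. z j \<noteq> 0} \<and>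
      0 = (\<Sum>j | z j \<noteq> 0. z j)" for z
  have "\<exists>!z. D z" using free unfolding free_graded_by_def D_def by blast
  moreover have "D (\<lambda>_. 0)" using zero by (simp add: D_def)
  moreover have "D y" using range_y fin y0 by (simp add: D_def)
  ultimately have "y = (\<lambda>_. 0)" by blast
  then have "scale (q i) (L i) = scale 0 (L i)" using \<open>i \<in> I\<close> by (metis y_def scale_zero_left)
  then show ?thesis using free unfolding free_graded_by_def by (meson injD)
qed

locale graded_virasoro = lie_conformal_algebra scale br
  for scale :: "complex poly \<Rightarrow> 'a::ab_group_add \<Rightarrow> 'a" and br :: "'a \<Rightarrow> 'a \<Rightarrow> 'a poly" +
  fixes L :: "nat \<Rightarrow> 'a" and p :: "nat \<Rightarrow> nat \<Rightarrow> complex poly poly"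
  assumes free_graded: "free_graded_by scale L"
    and br_L: "br (L i) (L j) = poly2_scale scale (p i j) (L (i + j))"
    and br_L0: "br (L 0) (L 0) = poly2_scale scale [:[:0, 1:], [:2:]:] (L 0)"
    and br_L1_neq_0: "br (L 1) (L i) \<noteq> 0"
begin

sublocale adj: lie_conformal_module scale br scale br
  by (rule adjoint_module)

lemma adj_pr: "adj.pr = adj.prA"
  by (intro ext) (simp add: adj.pr_def adj.prA_def)

lemma L_free: "scale q (L i) = 0 \<Longrightarrow> q = 0"
  using free_graded_by_independent[OF module_axioms free_graded, of "{i}" "\<lambda>_. q" i] by simp

lemma inj_L: "inj L"
proof (rule injI, rule ccontr)
  fix i j assume *: "L i = L j" "i \<noteq> j"
  let ?q = "\<lambda>k. if k = i then 1 else - 1 :: complex poly"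
  have "(\<Sum>k\<in>{i, j}. scale (?q k) (L k)) = 0" using * by simp
  then show False
    using free_graded_by_independent[OF module_axioms free_graded, of "{i, j}" ?q i] by simp
qed

lemma not_fin_dim_span_L: "\<not> adj.A.fin_dim (adj.A.V.span (range L))"
proof
  assume "adj.A.fin_dim (adj.A.V.span (range L))"
  then obtain B where B: "finite B" "adj.A.V.span (range L) \<subseteq> adj.A.V.span B"
    by (auto simp: fin_span_def)
  have "adj.A.V.independent (range L)"
    unfolding adj.A.V.independent_explicit_module
  proof (intro allI impI)
    fix t u v assume t: "finite t" "t \<subseteq> range L" "(\<Sum>v\<in>t. scale [:u v:] v) = 0" "v \<in> t"
    then obtain I where I: "finite I" "t = L ` I" by (meson finite_subset_image)
    have "(\<Sum>i\<in>I. scale [:u (L i):] (L i)) = 0"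
      using t(3) unfolding I(2) by (subst (asm) sum.reindex) (auto intro: inj_on_subset[OF inj_L])
    then show "u v = 0"
      using free_graded_by_independent[OF module_axioms free_graded I(1), of "\<lambda>i. [:u (L i):]"] t(4) I(2)
      by auto
  qed
  moreover have "range L \<subseteq> adj.A.V.span B" using B(2) adj.A.V.span_superset by blast
  ultimately have "finite (range L)" using adj.A.V.independent_span_bound[OF B(1)] by blast
  then show False using inj_L finite_imageD by blast
qed

lemma adj_pr_L: "adj.pr (L i) n (L j) = scale (smult (fact n) (coeff (p i j) n)) (L (i + j))"
  by (simp add: adj.pr_def br_L poly2_scale_def coeff_map_poly)

lemma primary_L0: "adj.primary (L 0) 0 2 (L 0)"
  by (auto simp: adj.primary_def adj.prA_def br_L0 poly2_scale_def coeff_map_poly coeff_pCons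
      split: nat.splits)

text \<open>The submodule generated by \<open>L i\<close> is a free Virasoro module of rank one
  under \<open>L 0\<close>, so \<open>virasoro_rank_one\<close> applies.\<close>

lemma br_L0_rank_one:
  assumes "br (L 0) (L i) \<noteq> 0"
  shows "\<exists>\<alpha> \<Delta>. adj.primary (L 0) \<alpha> \<Delta> (L i)"
proof -
  have "\<exists>q. adj.pr (L 0) n (L i) = scale q (L i)" for n
    using adj_pr_L[of 0 n i] by auto
  then show ?thesis
    using adj.virasoro_rank_one[OF primary_L0 L_free _ assms]
    by (auto simp: adj.primary_def adj_pr)
qed

text \<open>Bracketing with \<open>L 1\<close> shifts the weight by \<alpha>. As this bracket is
  never zero, the weight passes from \<open>L i\<close> to \<open>L (Suc i)\<close>.\<close>

lemma pr_L0_L_0: "\<exists>\<alpha>. \<forall>i. adj.pr (L 0) 0 (L i) = scale [:of_nat i * \<alpha>, 1:] (L i)"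
proof -
  have "br (L 0) (L 1) \<noteq> 0"
    using br_L1_neq_0[of 0] br_skew[of "L 1" "L 0"] by (auto simp: subst_var_def)
  then obtain \<alpha> \<Delta> where *: "adj.primary (L 0) \<alpha> \<Delta> (L 1)" using br_L0_rank_one by blast
  have "adj.pr (L 0) 0 (L i) = scale [:of_nat i * \<alpha>, 1:] (L i)" for i
  proof (induction i)
    case 0
    then show ?case using primary_L0 by (simp add: adj.primary_def adj_pr)
  next
    case (Suc i)
    obtain n where n: "adj.pr (L 1) n (L i) \<noteq> 0"
      using br_L1_neq_0[of i] by (auto simp: adj.act_eq_0_iff)
    obtain Q where Q: "adj.pr (L 1) n (L i) = scale Q (L (Suc i))"
      using adj_pr_L[of 1 n i] by auto
    obtain R where R: "adj.pr (L 0) 0 (L (Suc i)) = scale R (L (Suc i))"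
      using adj_pr_L[of 0 0 "Suc i"] by auto
    have "scale (Q * R) (L (Suc i)) = adj.pr (L 0) 0 (adj.pr (L 1) n (L i))"
      by (simp add: Q R adj.pr_0_scaleM del: One_nat_def)
    \<comment> \<open>The terms in \<open>n\<close> times product \<open>n - 1\<close>, one from the
      commutator and one from moving \<partial> out, cancel.\<close>
    also have "\<dots> = scale [:of_nat i * \<alpha>:] (adj.pr (L 1) n (L i))
        + partial scale (adj.pr (L 1) n (L i)) + scale [:\<alpha>:] (adj.pr (L 1) n (L i))"
      using adj.commutator_primary[OF *, of 0 n "L i"] adj.pr_scaleM_pCons[of "L 1" n _ 1 "L i"]
      by (simp add: Suc del: One_nat_def flip: one_pCons)
    also have "\<dots> = scale ([:of_nat (Suc i) * \<alpha>, 1:] * Q) (L (Suc i))"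
      unfolding Q by (simp add: algebra_simps smult_add_left flip: scale_left_distrib)
    finally have "scale ((R - [:of_nat (Suc i) * \<alpha>, 1:]) * Q) (L (Suc i)) = 0"
      by (simp add: left_diff_distrib scale_left_diff_distrib mult.commute[of R Q])
    then have "(R - [:of_nat (Suc i) * \<alpha>, 1:]) * Q = 0" by (rule L_free)
    moreover have "Q \<noteq> 0" using n Q by auto
    ultimately show ?case using R by simp
  qed
  then show ?thesis by blast
qed

text \<open>The polynomial \<partial> + i \<alpha> is nonzero, so every bracket with
  \<open>L 0\<close> is nonzero and has the rank one form.\<close>

theorem primary_L: "\<exists>\<alpha> \<Delta>. \<forall>i. adj.primary (L 0) (of_nat i * \<alpha>) (\<Delta> i) (L i)"
proof -
  obtain \<alpha> where \<alpha>: "\<And>i. adj.pr (L 0) 0 (L i) = scale [:of_nat i * \<alpha>, 1:] (L i)"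
    using pr_L0_L_0 by blast
  have "\<exists>\<Delta>. adj.primary (L 0) (of_nat i * \<alpha>) \<Delta> (L i)" for i
  proof -
    have "adj.pr (L 0) 0 (L i) \<noteq> 0" using \<alpha>[of i] L_free[of "[:of_nat i * \<alpha>, 1:]" i] by auto
    then have "br (L 0) (L i) \<noteq> 0" using adj.act_eq_0_iff by blast
    then obtain \<beta> \<Delta> where *: "adj.primary (L 0) \<beta> \<Delta> (L i)" using br_L0_rank_one by blast
    then show ?thesis using \<alpha>[of i] by (auto simp: adj.primary_def adj_pr)
  qed
  then show ?thesis by metis
qed

end

section \<open>Finite modules\<close>

text \<open>Horner form of the substitution, on which inductions over \<open>u\<close> rest.\<close>

lemma subst_var_pCons:
  assumes "f 0 = 0" "X 0 = 0" "\<And>x y. X (x + y) = X x + X y"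
  shows "subst_var f X (pCons c u) = f c + X (subst_var f X u)"
proof -
  have 0: "(X ^^ n) 0 = 0" for n by (induction n) (simp_all add: assms)
  have sum: "X (\<Sum>n\<in>A. g n) = (\<Sum>n\<in>A. X (g n))" if "finite A" for g and A :: "nat set"
    using that by (induction A) (simp_all add: assms)
  have "subst_var f X (pCons c u) = (\<Sum>n\<le>Suc (degree u). (X ^^ n) (f (coeff (pCons c u) n)))"
    unfolding subst_var_def
    by (intro sum.mono_neutral_left) (auto simp: coeff_eq_0 assms 0 degree_pCons_le)
  also have "\<dots> = f c + (\<Sum>n\<le>degree u. X ((X ^^ n) (f (coeff u n))))"
    by (subst sum.atMost_Suc_shift) simp
  finally show ?thesis by (simp add: subst_var_def sum)
qed

lemma subst_var_add:
  assumes "f 0 = 0" "X 0 = 0" "\<And>x y. X (x + y) = X x + X y" "\<And>x y. f (x + y) = f x + f y"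
  shows "subst_var f X (u + v) = subst_var f X u + subst_var f X v"
proof (induction u v rule: poly_induct2)
  case 0
  show ?case by (simp add: subst_var_def assms)
next
  case (pCons a p b q)
  then show ?case by (simp add: subst_var_pCons[of f X, OF assms(1-3)] assms(3,4) algebra_simps)
qed

section \<open>Finiteness of the top products of a Virasoro element\<close>

locale virasoro_module = lie_conformal_module scale br scaleM act
  for scale :: "complex poly \<Rightarrow> 'a::ab_group_add \<Rightarrow> 'a" and br :: "'a \<Rightarrow> 'a \<Rightarrow> 'a poly"
    and scaleM :: "complex poly \<Rightarrow> 'm::ab_group_add \<Rightarrow> 'm" and act :: "'a \<Rightarrow> 'm \<Rightarrow> 'm poly" +
  fixes a0 :: 'a and G :: "'m set"
  assumes vir: "primary a0 0 2 a0" and finite_G: "finite G" and span_G: "M.span G = UNIV"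
begin

abbreviation "sc \<equiv> \<lambda>c. scaleM [:c:]"

abbreviation "mult_shift \<equiv> \<lambda>u. mult_var u - map_poly (partial scaleM) u"

text \<open>The element \<open>a0\<^sub>\<lambda>\<^sub>-\<^sub>\<partial> w\<close>, with \<open>\<partial>\<close> acting on the left. This substitution turns the
  action of \<open>\<partial>\<close> on \<open>w\<close> into multiplication by \<open>\<lambda>\<close>, so that the coefficients of all
  \<open>a0\<^sub>\<lambda>\<^sub>-\<^sub>\<partial> w\<close> lie in the complex span of those for the generators.\<close>

definition shifted :: "'m \<Rightarrow> 'm poly" where
  "shifted w = subst_var (\<lambda>x. [:x:]) mult_shift (act a0 w)"

lemma coeff_mult_shift:
  "coeff (mult_shift u) n
     = (case n of 0 \<Rightarrow> 0 | Suc n' \<Rightarrow> coeff u n') - partial scaleM (coeff u n)"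
  by (simp add: mult_var_def coeff_pCons coeff_map_poly)

lemma mult_shift_add: "mult_shift (u + v) = mult_shift u + mult_shift v"
  by (rule poly_eqI) (auto simp: coeff_mult_shift M.scale_right_distrib simp del: coeff_diff split: nat.splits)

lemma mult_shift_0: "mult_shift 0 = 0"
  by (simp add: mult_var_def)

lemma subst_shift_pCons:
  "subst_var (\<lambda>x. [:x:]) mult_shift (pCons c u)
     = [:c:] + mult_shift (subst_var (\<lambda>x. [:x:]) mult_shift u)"
  by (rule subst_var_pCons[OF _ mult_shift_0 mult_shift_add]) simp_all

lemma subst_shift_add:
  "subst_var (\<lambda>x. [:x:]) mult_shift (u + v)
     = subst_var (\<lambda>x. [:x:]) mult_shift u + subst_var (\<lambda>x. [:x:]) mult_shift v"
  by (rule subst_var_add[OF _ mult_shift_0 mult_shift_add]) simp_all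

lemma coeff_subst_shift_map:
  assumes f: "f 0 = 0" "\<And>x y. f (x + y) = f x + f y"
    and comm: "\<And>x. f (partial scaleM x) = partial scaleM (f x)"
  shows "coeff (subst_var (\<lambda>x. [:x:]) mult_shift (map_poly f u)) n
      = f (coeff (subst_var (\<lambda>x. [:x:]) mult_shift u) n)"
proof (induction u arbitrary: n)
  case 0
  then show ?case by (simp add: f subst_var_def)
next
  case (pCons c u)
  have fm: "f (x - y) = f x - f y" for x y
    using f(2)[of "x - y" y] by (simp add: algebra_simps)
  show ?case
    using f by (simp add: subst_shift_pCons map_poly_pCons coeff_mult_shift pCons(2) f fm comm coeff_pCons
        del: coeff_diff split: nat.split)
qed

lemma shifted_add: "shifted (v + w) = shifted v + shifted w"
  by (simp add: shifted_def act_add_right subst_shift_add)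

lemma shifted_0: "shifted 0 = 0"
  using shifted_add[of 0 0] by simp

lemma coeff_shifted_scale: "coeff (shifted (sc c w)) n = sc c (coeff (shifted w) n)"
  unfolding shifted_def act_scale_right
  by (rule coeff_subst_shift_map) (simp_all add: M.scale_right_distrib)

lemma coeff_shifted_partial:
  "coeff (shifted (partial scaleM w)) n = (case n of 0 \<Rightarrow> 0 | Suc n' \<Rightarrow> coeff (shifted w) n')"
proof -
  have "coeff (subst_var (\<lambda>x. [:x:]) mult_shift (map_poly (partial scaleM) (act a0 w))) n
      = partial scaleM (coeff (shifted w) n)"
    unfolding shifted_def by (rule coeff_subst_shift_map) (simp_all add: M.scale_right_distrib)
  moreover have "subst_var (\<lambda>x. [:x:]) mult_shift (mult_var (act a0 w)) = mult_shift (shifted w)"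
    unfolding mult_var_def[of "act a0 w"] shifted_def by (subst subst_shift_pCons) simp
  ultimately show ?thesis
    unfolding shifted_def[of "partial scaleM w"] act_partial_right subst_shift_add coeff_add
      coeff_mult_shift by (simp add: mult_var_def coeff_pCons coeff_map_poly)
qed

text \<open>Replacing \<lambda> by \<lambda> - \<partial> alters only the coefficients below the
  leading one.\<close>

lemma coeff_subst_shift_top:
  assumes "\<forall>n>N. coeff u n = 0"
  shows "coeff (subst_var (\<lambda>x. [:x:]) mult_shift u) N = coeff u N \<and>
    (\<forall>n>N. coeff (subst_var (\<lambda>x. [:x:]) mult_shift u) n = 0)"
  using assms
proof (induction u arbitrary: N)
  case 0
  then show ?case by (simp add: subst_var_def)
next
  case (pCons c u)
  show ?case
  proof (cases N)
    case 0
    then have "u = 0" using pCons.prems by (auto simp: poly_eq_iff coeff_pCons split: nat.splits)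
    then have "subst_var (\<lambda>x. [:x:]) mult_shift (pCons c u) = [:c:]"
      by (subst subst_shift_pCons) (simp add: subst_var_def mult_var_def)
    then show ?thesis using 0 by (simp add: coeff_pCons split: nat.split)
  next
    case (Suc N')
    then have "\<forall>n>N'. coeff u n = 0" using pCons.prems by (auto simp: coeff_pCons split: nat.splits)
    from pCons.IH[OF this] Suc show ?thesis
      by (auto simp: subst_shift_pCons coeff_mult_shift coeff_pCons split: nat.split simp del: coeff_diff)
  qed
qed

text \<open>Up to a factorial, a top product of \<open>w\<close> is the top coefficient of
  \<open>shifted w\<close>, and all coefficients of \<open>shifted w\<close> lie in the complex span
  of those for the generators.\<close>

lemma fin_dim_top_coeffs:
  "P.fin_dim {pr a0 N w | N w. \<forall>p>N. pr a0 p w = 0}"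
proof -
  define C where "C = (\<Union>g\<in>G. set (coeffs (shifted g)))"
  have g: "coeff (shifted (scaleM q g)) n \<in> P.V.span C" if "g \<in> G" for q g n
  proof (induction q arbitrary: n)
    case 0
    then show ?case by (simp add: shifted_0 P.V.span_zero)
  next
    case (pCons c q)
    have "scaleM (pCons c q) g = sc c g + partial scaleM (scaleM q g)"
      by (simp flip: M.scale_left_distrib)
    then have "coeff (shifted (scaleM (pCons c q) g)) n = sc c (coeff (shifted g) n)
        + (case n of 0 \<Rightarrow> 0 | Suc n' \<Rightarrow> coeff (shifted (scaleM q g)) n')"
      by (simp only: shifted_add coeff_add coeff_shifted_scale coeff_shifted_partial)
    moreover have "coeff (shifted g) n \<in> P.V.span C"
    proof (cases "coeff (shifted g) n = 0")
      case False
      then have "coeff (shifted g) n \<in> set (coeffs (shifted g))"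
        using range_coeff[of "shifted g"] by blast
      then show ?thesis using \<open>g \<in> G\<close> by (intro P.V.span_base) (auto simp: C_def)
    qed (simp add: P.V.span_zero)
    ultimately show ?case using pCons(2)
      by (auto intro!: P.V.span_add P.V.span_scale P.V.span_zero split: nat.split)
  qed
  have *: "coeff (shifted w) n \<in> P.V.span C" for w n
  proof -
    have "w \<in> M.span G" using span_G by simp
    then show ?thesis
      by (induction rule: M.span_induct_alt)
        (auto simp: shifted_0 shifted_add P.V.span_zero intro!: P.V.span_add g)
  qed
  have "pr a0 N w \<in> P.V.span C" if "\<forall>p>N. pr a0 p w = 0" for N w
  proof -
    have "coeff (shifted w) N = coeff (act a0 w) N"
      using coeff_subst_shift_top[of N "act a0 w"] that unfolding shifted_def pr_eq_0_iff by blast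
    then show ?thesis using *[of w N] unfolding pr_def by (metis P.V.span_scale)
  qed
  moreover have "finite C" using finite_G by (auto simp: C_def)
  ultimately show ?thesis unfolding fin_span_def by blast
qed

section \<open>The kernel \<open>Z\<close> and the operator \<open>T\<close>\<close>

definition "Z = {v. \<forall>p. pr a0 p v = 0}"

definition T :: "'m \<Rightarrow> 'm" where
  "T v = pr a0 0 v - partial scaleM v"

lemma T_linear: "Vector_Spaces.linear sc sc T"
  by unfold_locales (simp_all add: T_def pr_add pr_scale M.scale_right_distrib M.scale_right_diff_distrib)

sublocale T: operator sc T
  by (intro operator.intro P.V.vector_space_axioms T_linear)

lemma scaleM_linear: "Vector_Spaces.linear sc sc (scaleM q)"
  by unfold_locales (simp_all add: M.scale_right_distrib mult.commute)

lemma T_scaleM: "T (scaleM q v) = scaleM q (T v)"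
  by (simp add: T_def pr_0_scaleM M.scale_right_diff_distrib mult.commute)

lemma poly_op_T_scaleM: "poly_op sc T h (scaleM q v) = scaleM q (poly_op sc T h v)"
  by (rule T.poly_op_intertwine[OF scaleM_linear T_scaleM[symmetric] T_linear, symmetric])

text \<open>The terms in \<open>pr b (n - 1) v\<close> coming from \<open>pr a0 0\<close> and from
  \<partial> cancel, so only the shift by \<alpha> remains.\<close>

lemma T_primary:
  assumes "primary a0 \<alpha> \<Delta> b"
  shows "T (pr b n v) = pr b n (T v) + sc \<alpha> (pr b n v)"
  by (simp add: T_def commutator_primary[OF assms] pr_diff pr_partial)

lemma T_a0: "T (pr a0 n v) = pr a0 n (T v)"
  using T_primary[OF vir] by simp

lemma subspace_Z: "M.subspace Z"
  unfolding Z_def by (rule subspace_annihilator)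

lemma T_Z: "v \<in> Z \<Longrightarrow> T v \<in> Z"
  by (auto simp: Z_def T.zero simp flip: T_a0)

lemma poly_op_T_Z: "v \<in> Z \<Longrightarrow> poly_op sc T h v \<in> Z"
  by (rule T.poly_op_closed[OF _ T_Z])
    (use subspace_Z in \<open>auto simp: M.subspace_def P.V.subspace_def\<close>)

text \<open>With p = 0 the commutator relation expresses n + 1 times \<open>pr b n z\<close> through
  \<open>pr b (Suc n) z\<close>, so vanishing descends from large indices.\<close>

lemma primary_kills_Z:
  assumes b: "primary a0 \<alpha> \<Delta> b" and z: "z \<in> Z"
  shows "pr b n z = 0"
proof -
  have step: "pr b n z = 0" if "pr b (Suc n) z = 0" for n
  proof -
    have "sc (- of_nat (Suc n)) (pr b n z) = 0"
      using commutator_primary[OF b, of 0 "Suc n" z] z that by (simp add: Z_def del: of_nat_Suc)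
    then show ?thesis unfolding P.V.scale_eq_0_iff by (simp del: of_nat_Suc)
  qed
  obtain N where N: "\<And>n. n \<ge> N \<Longrightarrow> pr b n z = 0" using pr_eventually_0 by blast
  show ?thesis
  proof (cases "n \<le> N")
    case True
    then show ?thesis by (induction rule: inc_induct) (auto simp: N step)
  qed (simp add: N)
qed

text \<open>Since \<open>T\<close> commutes with \<open>pr a0 N\<close>, all h(T)
  \<open>pr a0 N v\<close> are again top products and stay in a space of finite dimension. An
  annihilating h removes the highest product, and the induction ends in \<open>Z\<close>.\<close>

lemma poly_op_T_to_Z:
  assumes "\<forall>p\<ge>N. pr a0 p v = 0"
  shows "\<exists>h. h \<noteq> 0 \<and> poly_op sc T h v \<in> Z"
  using assms
proof (induction N arbitrary: v)
  case 0
  then show ?case by (intro exI[of _ 1]) (simp add: Z_def)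
next
  case (Suc N)
  have comm: "poly_op sc T h (pr a0 p v) = pr a0 p (poly_op sc T h v)" for h p
    by (rule T.poly_op_intertwine[OF pr_linear T_a0[symmetric] T_linear, symmetric])
  have 0: "pr a0 p (poly_op sc T h v) = 0" if "p > N" for p h
    using Suc.prems that by (simp flip: comm)
  have "poly_op sc T h (pr a0 N v) \<in> {pr a0 N w | N w. \<forall>p>N. pr a0 p w = 0}" for h
    using 0 unfolding comm by blast
  then obtain h1 where h1: "h1 \<noteq> 0" "poly_op sc T h1 (pr a0 N v) = 0"
    using T.fin_span_annihilator[OF fin_dim_top_coeffs] by blast
  then have "\<forall>p\<ge>N. pr a0 p (poly_op sc T h1 v) = 0"
    using 0 by (metis comm le_neq_implies_less)
  then obtain h2 where h2: "h2 \<noteq> 0" "poly_op sc T h2 (poly_op sc T h1 v) \<in> Z"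
    using Suc.IH by blast
  then have "h2 * h1 \<noteq> 0" "poly_op sc T (h2 * h1) v \<in> Z"
    using h1 by (simp_all add: T.poly_op_mult)
  then show ?case by blast
qed

text \<open>As h(T) commutes with \<partial>, the product of the polynomials found for the
  generators serves the whole module.\<close>

lemma poly_op_T_uniform: "\<exists>h. h \<noteq> 0 \<and> (\<forall>v. poly_op sc T h v \<in> Z)"
proof -
  have "\<exists>h. h \<noteq> 0 \<and> poly_op sc T h g \<in> Z" for g
    using pr_eventually_0[of a0 g] poly_op_T_to_Z by blast
  then obtain H where H: "\<And>g. H g \<noteq> 0 \<and> poly_op sc T (H g) g \<in> Z" by metis
  define h where "h = prod H G"
  have "poly_op sc T h g \<in> Z" if "g \<in> G" for g
  proof -
    have "h = prod H (G - {g}) * H g"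
      using finite_G that by (simp add: h_def prod.remove[of G g] mult.commute)
    then show ?thesis using H[of g] by (simp add: T.poly_op_mult poly_op_T_Z)
  qed
  moreover have "M.subspace {v. poly_op sc T h v \<in> Z}"
    using subspace_Z by (auto simp: M.subspace_def poly_op_T_scaleM T.poly_op_add)
  ultimately have "M.span G \<subseteq> {v. poly_op sc T h v \<in> Z}"
    by (intro M.span_minimal) auto
  then have "\<forall>v. poly_op sc T h v \<in> Z" using span_G by auto
  moreover have "h \<noteq> 0" using finite_G H by (auto simp: h_def)
  ultimately show ?thesis by blast
qed

end

section \<open>Weights\<close>

lemma gbinomial_poly: "\<exists>B. degree B \<le> i \<and> (\<forall>x. poly B x = (x :: 'f::field_char_0) gchoose i)"
proof (intro exI conjI allI)
  let ?B = "smult (1 / fact i) (\<Prod>k=0..<i. [:- of_nat k, 1:]) :: 'f poly"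
  have "degree (\<Prod>k=0..<i. [:- of_nat k, 1:] :: 'f poly) \<le> (\<Sum>k=0..<i. 1)"
    by (rule degree_prod_sum_le[THEN order.trans]) (auto intro!: sum_mono)
  then show "degree ?B \<le> i" by (intro order.trans[OF degree_smult_le]) simp
  show "poly ?B x = x gchoose i" for x
    by (simp add: poly_prod gbinomial_prod_rev)
qed

context virasoro_module
begin

lemma scaleM_partial_eigen:
  assumes "partial scaleM u = sc \<gamma> u"
  shows "scaleM q u = sc (poly q \<gamma>) u"
proof (induction q)
  case (pCons c q)
  have "scaleM (pCons c q) u = sc c u + partial scaleM (scaleM q u)"
    by (simp flip: M.scale_left_distrib)
  also have "partial scaleM (scaleM q u) = sc (poly q \<gamma>) (partial scaleM u)"
    unfolding pCons(2) by (simp add: mult.commute)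
  finally show ?case unfolding assms by (simp add: mult.commute flip: M.scale_left_distrib)
qed simp

lemma finite_weights:
  "\<exists>C. finite C \<and> (\<forall>b c \<Delta>. primary a0 c \<Delta> b \<longrightarrow> (\<exists>v. act b v \<noteq> 0) \<longrightarrow> c \<in> C)"
proof -
  obtain h where h: "h \<noteq> 0" "\<And>v. poly_op sc T h v \<in> Z" using poly_op_T_uniform by blast
  obtain q where q: "q \<noteq> 0" "\<And>p v. p \<noteq> 0 \<Longrightarrow> scaleM p v = 0 \<Longrightarrow> scaleM q v = 0"
    using P.torsion_annihilator[OF finite_G span_G] by blast
  define Rh where "Rh = {x. poly h x = 0}"
  define Rq where "Rq = {x. poly q x = 0}"
  \<comment> \<open>The weight is a difference of two roots of \<open>h\<close>, or comes from a
    root of \<open>q\<close> as eigenvalue of \<partial> on a torsion vector and a root of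
    \<open>h\<close>.\<close>
  define C where "C = (\<lambda>(x, y). x - y) ` (Rh \<times> Rh) \<union> (\<lambda>(x, y). - x - y) ` (Rq \<times> Rh)"
  have "finite C"
    using h(1) q(1) by (auto simp: C_def Rh_def Rq_def poly_roots_finite)
  moreover have "c \<in> C" if b: "primary a0 c \<Delta> b" and nz: "act b v \<noteq> 0" for b c \<Delta> v
  proof -
    obtain n where n: "pr b n v \<noteq> 0" using nz act_eq_0_iff by blast
    \<comment> \<open>On the image of \<open>pr b n\<close> this operator stands for
      \<open>T\<close>: applying h(U) there is applying h(T) first, which lands in \<open>Z\<close>,
      and \<open>b\<close> kills \<open>Z\<close>.\<close>
    define U where "U x = T x - sc c x" for x
    have U_linear: "Vector_Spaces.linear sc sc U"
      by unfold_locales (simp_all add: U_def T.add T.scale M.scale_right_distrib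
          M.scale_right_diff_distrib mult.commute)
    interpret U: operator sc U by (intro operator.intro P.V.vector_space_axioms U_linear)
    have "pr b n (T x) = U (pr b n x)" for x
      using T_primary[OF b] by (simp add: U_def)
    then have "poly_op sc U h (pr b n v) = pr b n (poly_op sc T h v)"
      using T.poly_op_intertwine[OF pr_linear _ U_linear] by metis
    then have "poly_op sc U h (pr b n v) = 0" using primary_kills_Z[OF b h(2)] by simp
    moreover have "\<exists>z. poly g z = 0" if "degree g > 0" for g :: "complex poly"
      using fundamental_theorem_of_algebra[of g] that by (simp add: constant_degree)
    ultimately obtain u \<beta> where u: "u \<noteq> 0" "U u = sc \<beta> u" "poly h \<beta> = 0"
      using U.poly_op_eigenvector[of h "pr b n v"] h(1) n by blast
    have Tu: "T u = sc (\<beta> + c) u"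
    proof -
      have "T u = U u + sc c u" by (simp add: U_def)
      then show ?thesis unfolding u(2) by (simp flip: M.scale_left_distrib)
    qed
    show ?thesis
    proof (cases "poly h (\<beta> + c) = 0")
      case True
      then have "(\<beta> + c, \<beta>) \<in> Rh \<times> Rh" using u(3) by (simp add: Rh_def)
      then show ?thesis unfolding C_def by (intro UnI1) (force intro: rev_image_eqI)
    next
      case False
      \<comment> \<open>Now h(T) u is a nonzero multiple of \<open>u\<close>, so \<open>u\<close>
        lies in \<open>Z\<close>. There \<open>T\<close> is -\<partial>, which makes
        \<open>u\<close> a torsion eigenvector of \<partial>.\<close>
      have "sc (poly h (\<beta> + c)) u \<in> Z" using h(2)[of u] T.poly_op_eigen[OF Tu] by simp
      then have "sc (inverse (poly h (\<beta> + c))) (sc (poly h (\<beta> + c)) u) \<in> Z"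
        using subspace_Z M.subspace_scale by blast
      then have "u \<in> Z" using False by (simp flip: one_pCons)
      then have "T u = - partial scaleM u" by (simp add: T_def Z_def)
      then have du: "partial scaleM u = sc (- (\<beta> + c)) u"
        unfolding Tu using P.V.scale_minus_left[of "\<beta> + c" u] by (metis minus_minus)
      then have "scaleM [:\<beta> + c, 1:] u = 0"
        by (subst scaleM_partial_eigen[OF du]) simp
      then have "scaleM q u = 0" by (rule q(2)[rotated]) simp
      then have "sc (poly q (- (\<beta> + c))) u = 0" using scaleM_partial_eigen[OF du] by simp
      then have "poly q (- (\<beta> + c)) = 0" using u(1) P.V.scale_eq_0_iff by blast
      then have "(- (\<beta> + c), \<beta>) \<in> Rq \<times> Rh" using u(3) by (simp add: Rh_def Rq_def)
      then show ?thesis unfolding C_def by (intro UnI2) (force intro: rev_image_eqI)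
    qed
  qed
  ultimately show ?thesis by blast
qed

text \<open>On the line p + q = s such an \<open>f\<close> is a vector-valued polynomial in p of
  degree at most 2 I. The coefficients \<open>x\<close> may depend on \<open>s\<close>; the bound
  \<open>I\<close> is meant to be the same for all \<open>s\<close>.\<close>

definition binom_comb :: "nat \<Rightarrow> nat \<Rightarrow> (nat \<Rightarrow> nat \<Rightarrow> 'm) \<Rightarrow> bool" where
  "binom_comb I s f \<longleftrightarrow> (\<exists>x. \<forall>p q. p + q = s \<longrightarrow>
     f p q = (\<Sum>(i, j)\<in>{..I} \<times> {..I}. sc (of_nat ((p choose i) * (q choose j))) (x (i, j))))"

lemma binom_comb_add:
  assumes "binom_comb I s f" "binom_comb I s g"
  shows "binom_comb I s (\<lambda>p q. f p q + g p q)"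
proof -
  obtain x y where x: "\<forall>p q. p + q = s \<longrightarrow> f p q
      = (\<Sum>(i, j)\<in>{..I} \<times> {..I}. sc (of_nat ((p choose i) * (q choose j))) (x (i, j)))"
    and y: "\<forall>p q. p + q = s \<longrightarrow> g p q
      = (\<Sum>(i, j)\<in>{..I} \<times> {..I}. sc (of_nat ((p choose i) * (q choose j))) (y (i, j)))"
    using assms unfolding binom_comb_def by blast
  show ?thesis unfolding binom_comb_def
    by (intro exI[of _ "\<lambda>k. x k + y k"] allI impI)
      (simp add: x y M.scale_right_distrib sum.distrib case_prod_beta del: of_nat_mult)
qed

lemma binom_comb_scale:
  assumes "binom_comb I s f"
  shows "binom_comb I s (\<lambda>p q. scaleM r (f p q))"
proof -
  obtain x where x: "\<forall>p q. p + q = s \<longrightarrow> f p q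
      = (\<Sum>(i, j)\<in>{..I} \<times> {..I}. sc (of_nat ((p choose i) * (q choose j))) (x (i, j)))"
    using assms unfolding binom_comb_def by blast
  show ?thesis unfolding binom_comb_def
    by (intro exI[of _ "\<lambda>k. scaleM r (x k)"] allI impI)
      (simp add: x M.scale_sum_right case_prod_beta mult.commute del: of_nat_mult)
qed

text \<open>Up to the factor \<open>s - i - j\<close>, the functions \<open>(p, q) \<mapsto> (p choose i) (q choose j)\<close> on the
  lines \<open>p + q = s\<close> are stable under the operation that \<open>\<partial>\<close> induces; their degree does not grow.\<close>

lemma binom_comb_shift:
  assumes "s > 0 \<Longrightarrow> binom_comb I (s - 1) f"
  shows "binom_comb I s (\<lambda>p q. sc (of_nat p) (f (p - 1) q) + sc (of_nat q) (f p (q - 1)))"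
proof (cases "s = 0")
  case True
  then show ?thesis unfolding binom_comb_def by (intro exI[of _ "\<lambda>_. 0"]) simp
next
  case False
  then obtain x where x: "\<forall>p q. p + q = s - 1 \<longrightarrow> f p q
      = (\<Sum>(i, j)\<in>{..I} \<times> {..I}. sc (of_nat ((p choose i) * (q choose j))) (x (i, j)))"
    using assms unfolding binom_comb_def by blast
  let ?y = "\<lambda>(i, j). sc (of_nat s - of_nat i - of_nat j) (x (i, j))"
  have "sc (of_nat p) (f (p - 1) q) + sc (of_nat q) (f p (q - 1))
      = (\<Sum>(i, j)\<in>{..I} \<times> {..I}. sc (of_nat ((p choose i) * (q choose j))) (?y (i, j)))"
    if s: "p + q = s" for p q
  proof -
    have 1: "sc (of_nat p) (f (p - 1) q) = (\<Sum>(i, j)\<in>{..I} \<times> {..I}.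
        sc (of_nat (p * (p - 1 choose i) * (q choose j))) (x (i, j)))"
    proof (cases "p = 0")
      case False
      then have "p - 1 + q = s - 1" using s by simp
      with x have "f (p - 1) q = (\<Sum>(i, j)\<in>{..I} \<times> {..I}.
          sc (of_nat ((p - 1 choose i) * (q choose j))) (x (i, j)))" by blast
      then show ?thesis by (simp add: M.scale_sum_right case_prod_beta mult_ac)
    qed simp
    have 2: "sc (of_nat q) (f p (q - 1)) = (\<Sum>(i, j)\<in>{..I} \<times> {..I}.
        sc (of_nat ((p choose i) * (q * (q - 1 choose j)))) (x (i, j)))"
    proof (cases "q = 0")
      case False
      then have "p + (q - 1) = s - 1" using s by simp
      with x have "f p (q - 1) = (\<Sum>(i, j)\<in>{..I} \<times> {..I}.
          sc (of_nat ((p choose i) * (q - 1 choose j))) (x (i, j)))" by blast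
      then show ?thesis by (simp add: M.scale_sum_right case_prod_beta mult_ac)
    qed simp
    \<comment> \<open>By absorption, p (p - 1 choose i) = (p - i) (p choose i), and likewise for q;
      the two factors add up to s - i - j. Outside i \<le> p, j \<le> q both sides vanish.\<close>
    have 3: "of_nat (p * (p - 1 choose i) * (q choose j)) + of_nat ((p choose i) * (q * (q - 1 choose j)))
        = (of_nat ((p choose i) * (q choose j)) * (of_nat s - of_nat i - of_nat j) :: complex)" for i j
    proof (cases "i \<le> p \<and> j \<le> q")
      case True
      have "p * (p - 1 choose i) * (q choose j) + (p choose i) * (q * (q - 1 choose j))
          = (p - i) * (p choose i) * (q choose j) + (p choose i) * ((q - j) * (q choose j))"
        by (simp only: binomial_absorb_comp)
      also have "of_nat \<dots> = (of_nat ((p choose i) * (q choose j)) * (of_nat s - of_nat i - of_nat j) :: complex)"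
        using True unfolding s[symmetric] of_nat_add of_nat_mult
        by (simp only: of_nat_diff) (simp add: algebra_simps)
      finally show ?thesis by simp
    next
      case False
      then show ?thesis by (auto simp: binomial_eq_0)
    qed
    show ?thesis unfolding 1 2 sum.distrib[symmetric]
    proof (intro sum.cong refl)
      fix k assume "k \<in> {..I} \<times> {..I}"
      obtain i j where k: "k = (i, j)" by (cases k)
      show "(case k of (i, j) \<Rightarrow> sc (of_nat (p * (p - 1 choose i) * (q choose j))) (x (i, j)))
          + (case k of (i, j) \<Rightarrow> sc (of_nat ((p choose i) * (q * (q - 1 choose j)))) (x (i, j)))
          = (case k of (i, j) \<Rightarrow> sc (of_nat ((p choose i) * (q choose j))) (?y (i, j)))"
        unfolding k using 3[of i j] P.V.scale_left_distrib P.V.scale_scale by (simp only: prod.case) metis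
    qed
  qed
  then show ?thesis unfolding binom_comb_def by blast
qed

text \<open>On p + q = s, the product (p choose i) (q choose j) with i + j = s is the indicator of
  (p, q) = (i, j), so the values of \<open>f\<close> serve as coefficients.\<close>

lemma binom_comb_delta:
  assumes "\<And>p q. \<not> (p \<le> I \<and> q \<le> I) \<Longrightarrow> f p q = 0"
  shows "binom_comb I s f"
proof -
  let ?x = "\<lambda>(i, j). if i + j = s then f i j else 0"
  have "f p q = (\<Sum>(i, j)\<in>{..I} \<times> {..I}. sc (of_nat ((p choose i) * (q choose j))) (?x (i, j)))"
    if s: "p + q = s" for p q
  proof -
    have "sc (of_nat ((p choose i) * (q choose j))) (?x (i, j)) = (if (i, j) = (p, q) then f p q else 0)"
      for i j
    proof -
      consider "(i, j) = (p, q)" | "i + j \<noteq> s" | "i > p" | "j > q" using s by fastforce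
      then show ?thesis using s by cases (auto simp flip: one_pCons)
    qed
    then have "(\<Sum>(i, j)\<in>{..I} \<times> {..I}. sc (of_nat ((p choose i) * (q choose j))) (?x (i, j)))
        = (\<Sum>k\<in>{..I} \<times> {..I}. if k = (p, q) then f p q else 0)"
      by (intro sum.cong refl) (auto simp only: split: prod.split)
    then show ?thesis using assms[of p q] by (auto simp: sum.delta)
  qed
  then show ?thesis unfolding binom_comb_def by blast
qed

lemma binom_comb_a0: "\<exists>I. \<forall>s w. binom_comb I s (\<lambda>p q. pr a0 p (pr a0 q w))"
proof -
  have "\<exists>I. \<forall>p q. \<not> (p \<le> I \<and> q \<le> I) \<longrightarrow> pr a0 p (pr a0 q g) = 0" for g
  proof -
    obtain N where N: "\<And>q. q \<ge> N \<Longrightarrow> pr a0 q g = 0" using pr_eventually_0 by blast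
    have "\<forall>q. \<exists>K. \<forall>p\<ge>K. pr a0 p (pr a0 q g) = 0" using pr_eventually_0 by blast
    then obtain K where K: "\<And>q p. p \<ge> K q \<Longrightarrow> pr a0 p (pr a0 q g) = 0" by metis
    \<comment> \<open>From \<open>N\<close> on the inner product vanishes; for the finitely many
      smaller \<open>q\<close> the bound \<open>K q\<close> controls the outer one.\<close>
    define I where "I = Max (insert N (K ` {..<N}))"
    have I: "N \<le> I" "q < N \<Longrightarrow> K q \<le> I" for q by (auto simp: I_def)
    have "pr a0 p (pr a0 q g) = 0" if "\<not> (p \<le> I \<and> q \<le> I)" for p q
    proof (cases "q < N")
      case True
      then show ?thesis using I(2)[OF True] I(1) that by (intro K) linarith
    qed (simp add: N)
    then show ?thesis by blast
  qed
  then obtain J where J: "\<And>g p q. \<not> (p \<le> J g \<and> q \<le> J g) \<Longrightarrow> pr a0 p (pr a0 q g) = 0" by metis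
  define I where "I = Max (insert 0 (J ` G))"
  have JI: "J g \<le> I" if "g \<in> G" for g using that finite_G by (auto simp: I_def)
  have gen: "binom_comb I s (\<lambda>p q. pr a0 p (pr a0 q (scaleM r g)))" if g: "g \<in> G" for s r g
  proof (induction r arbitrary: s)
    case 0
    then show ?case unfolding binom_comb_def by (intro exI[of _ "\<lambda>_. 0"]) simp
  next
    case (pCons c r)
    let ?f = "\<lambda>p q. pr a0 p (pr a0 q (scaleM r g))"
    \<comment> \<open>Multiplication by \<partial> yields \<partial> itself and the index shifts of
      \<open>binom_comb_shift\<close>, neither of which enlarges \<open>I\<close>.\<close>
    have "pr a0 p (pr a0 q (scaleM (pCons c r) g)) = sc c (pr a0 p (pr a0 q g))
        + partial scaleM (?f p q) + (sc (of_nat p) (?f (p - 1) q) + sc (of_nat q) (?f p (q - 1)))" for p q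
      by (simp add: pr_scaleM_pCons pr_add pr_scale pr_partial algebra_simps)
    moreover have "binom_comb I s (\<lambda>p q. pr a0 p (pr a0 q g))"
      using J JI[OF g] by (intro binom_comb_delta) (meson le_trans)
    ultimately show ?case
      by (simp only:) (intro binom_comb_add binom_comb_scale binom_comb_shift pCons(2))
  qed
  have "binom_comb I s (\<lambda>p q. pr a0 p (pr a0 q w))" for s w
  proof -
    have "w \<in> M.span G" using span_G by simp
    then show ?thesis
    proof (induction rule: M.span_induct_alt)
      case base
      then show ?case unfolding binom_comb_def by (intro exI[of _ "\<lambda>_. 0"]) simp
    next
      case (step r g y)
      then show ?case by (simp only: pr_add) (intro binom_comb_add gen)
    qed
  qed
  then show ?thesis by blast
qed

end

section \<open>Uniform bounds in weight zero\<close>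

context virasoro_module
begin

text \<open>A functional makes the values scalar, so that roots can be counted; q becomes s - p in
  the second binomial.\<close>

lemma binom_comb_poly:
  assumes f: "binom_comb I s f" and l: "Vector_Spaces.linear sc (*) l"
  shows "\<exists>F. degree F \<le> 2 * I \<and> (\<forall>p\<le>s. l (f p (s - p)) = poly F (of_nat p))"
proof -
  interpret l: Vector_Spaces.linear sc "(*) :: complex \<Rightarrow> complex \<Rightarrow> complex" l by (rule l)
  obtain x where x: "\<forall>p q. p + q = s \<longrightarrow> f p q
      = (\<Sum>(i, j)\<in>{..I} \<times> {..I}. sc (of_nat ((p choose i) * (q choose j))) (x (i, j)))"
    using f unfolding binom_comb_def by blast
  obtain B :: "nat \<Rightarrow> complex poly" where B: "\<And>i. degree (B i) \<le> i" "\<And>i x. poly (B i) x = x gchoose i"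
    using gbinomial_poly by metis
  define F where "F = (\<Sum>(i, j)\<in>{..I} \<times> {..I}. smult (l (x (i, j))) (B i * pcompose (B j) [:of_nat s, -1:]))"
  have "degree F \<le> 2 * I"
    unfolding F_def
  proof (intro degree_sum_le)
    fix k assume k: "k \<in> {..I} \<times> {..I}"
    obtain i j where ij: "k = (i, j)" by (cases k)
    have "degree (smult (l (x (i, j))) (B i * pcompose (B j) [:of_nat s, -1:])) \<le> degree (B i) + degree (B j)"
      by (intro order.trans[OF degree_smult_le] order.trans[OF degree_mult_le] add_mono
          order.trans[OF degree_pcompose_le]) auto
    also have "\<dots> \<le> 2 * I" using B(1)[of i] B(1)[of j] k ij by auto
    finally show "degree (case k of (i, j) \<Rightarrow> smult (l (x (i, j))) (B i * pcompose (B j) [:of_nat s, -1:])) \<le> 2 * I"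
      by (simp add: ij)
  qed auto
  moreover have "l (f p (s - p)) = poly F (of_nat p)" if p: "p \<le> s" for p
  proof -
    have "of_nat s + - of_nat p = (of_nat (s - p) :: complex)" using p by (simp add: of_nat_diff)
    then have "poly F (of_nat p) = (\<Sum>(i, j)\<in>{..I} \<times> {..I}. l (x (i, j)) *
        (of_nat (p choose i) * of_nat ((s - p) choose j)))"
      by (simp add: F_def poly_sum case_prod_beta poly_pcompose B(2) flip: binomial_gbinomial)
    moreover have "f p (s - p)
      = (\<Sum>(i, j)\<in>{..I} \<times> {..I}. sc (of_nat ((p choose i) * ((s - p) choose j))) (x (i, j)))"
      using x p by simp
    ultimately show ?thesis
      by (simp only: l.sum l.scale case_prod_unfold of_nat_mult) (simp only: mult_ac)
  qed
  ultimately show ?thesis by blast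
qed

lemma exists_functional:
  assumes "x \<noteq> 0"
  shows "\<exists>l. Vector_Spaces.linear sc (*) l \<and> l x = (1 :: complex)"
proof -
  interpret C: vector_space "(*) :: complex \<Rightarrow> complex \<Rightarrow> complex"
    by unfold_locales (simp_all add: algebra_simps)
  interpret pair: vector_space_pair sc "(*) :: complex \<Rightarrow> complex \<Rightarrow> complex" ..
  have "P.V.independent {x}" using assms by (simp add: P.V.dependent_single)
  from pair.linear_independent_extend[OF this, of "\<lambda>_. 1"] show ?thesis by auto
qed

text \<open>With \<open>L\<^sub>q = (a0)\<^sub>(\<^sub>q\<^sub>)\<close>, \<open>e = \<Delta> - 1\<close> and \<open>w = b\<^sub>(\<^sub>n\<^sub>0\<^sub>) v\<close>, let \<open>L\<^sub>r w\<close> be the last nonzero one among the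
  elements
  \<open>L\<^sub>q w\<close>. The commutator relations give \<open>L\<^sub>p L\<^sub>q w\<close>, for \<open>p + q = r + 1\<close> and \<open>p, q \<ge> N\<close>, as an explicit
  quadratic polynomial in \<open>p\<close> times \<open>L\<^sub>r w\<close>. If \<open>r\<close> is large, this formula extends to \<open>p = 0\<close> because
  \<open>L\<^sub>p L\<^sub>q w\<close> depends on \<open>p\<close> as a polynomial of bounded degree; but there the left-hand side vanishes and
  the right-hand side does not.\<close>

lemma primary_top_bound:
  assumes I: "\<And>s w. binom_comb I s (\<lambda>p q. pr a0 p (pr a0 q w))"
    and v: "\<And>q. q \<ge> N \<Longrightarrow> pr a0 q v = 0" and N: "N \<ge> 1"
    and b: "primary a0 0 \<Delta> b" and n0: "n0 = (if \<Delta> = 1 then 1 else 0)"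
    and r: "r \<ge> 2 * N + 2 * I + 2" and top: "\<And>q. q > r \<Longrightarrow> pr a0 q (pr b n0 v) = 0"
  shows "pr a0 r (pr b n0 v) = 0"
proof (rule ccontr)
  define e where "e = \<Delta> - 1"
  define w where "w = pr b n0 v"
  assume "pr a0 r (pr b n0 v) \<noteq> 0"
  then have Lr: "pr a0 r w \<noteq> 0" by (simp add: w_def)
  have comm: "pr a0 p (pr b n v) = sc (of_nat p * e - of_nat n) (pr b (p + n - 1) v)" if "p \<ge> N" for p n
    using commutator_primary[OF b, of p n v] v[OF that] by (simp add: e_def)
  obtain l where l: "Vector_Spaces.linear sc (*) l" "l (pr a0 r w) = (1 :: complex)"
    using exists_functional[OF Lr] by blast
  interpret l: Vector_Spaces.linear sc "(*) :: complex \<Rightarrow> complex \<Rightarrow> complex" l by (rule l)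
  define s where "s = Suc r"
  define K where "K = of_nat r * e - of_nat n0"
  obtain F where F: "degree F \<le> 2 * I" "\<And>p. p \<le> s \<Longrightarrow> l (pr a0 p (pr a0 (s - p) w)) = poly F (of_nat p)"
    using binom_comb_poly[OF I l(1), of s w] by blast
  \<comment> \<open>Applying \<open>comm\<close> twice gives L_p L_q w as a multiple of the same
    vector that \<open>Lrw\<close> scales by \<open>K\<close>. Hence K L_p L_q w = Q(p) L_r w,
    without dividing by \<open>K\<close>.\<close>
  define Q where "Q = [:of_nat s * e - of_nat n0, - e:] * [:- of_nat s - of_nat n0 + 1, e + 1:]"
  have Lrw: "pr a0 r w = sc K (pr b (r + n0 - 1) v)"
    using comm[of r n0] r by (simp add: w_def K_def)
  have eq: "K * poly F (of_nat p) = poly Q (of_nat p)" if p: "p \<ge> N" "p \<le> s - N" for p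
  proof -
    define q where "q = s - p"
    have q: "q \<ge> N" "p + q = s" "p \<le> s" using p r by (auto simp: q_def s_def)
    have "of_nat q = (of_nat s - of_nat p :: complex)" using q by (auto simp flip: q(2))
    moreover have "pr a0 p (pr a0 q w) = sc (of_nat q * e - of_nat n0)
        (sc (of_nat p * e - of_nat (q + n0 - 1)) (pr b (p + (q + n0 - 1) - 1) v))"
      unfolding w_def comm[OF q(1)] pr_scale comm[OF p(1)] ..
    moreover have "p + (q + n0 - 1) - 1 = r + n0 - 1" using q N by (simp add: s_def)
    moreover have "of_nat (q + n0 - 1) = (of_nat q + of_nat n0 - 1 :: complex)"
      using q N by (simp add: of_nat_diff)
    moreover have "poly Q (of_nat p) = ((of_nat s - of_nat p) * e - of_nat n0)
        * (of_nat p * e - (of_nat s - of_nat p + of_nat n0 - 1))"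
      unfolding Q_def poly_mult by (rule arg_cong2[of _ _ _ _ "(*)"]) (simp_all add: algebra_simps)
    ultimately have "sc K (pr a0 p (pr a0 q w)) = sc (poly Q (of_nat p)) (pr a0 r w)"
      unfolding Lrw by (simp only: P.V.scale_scale mult_ac)
    then have "l (sc K (pr a0 p (pr a0 q w))) = l (sc (poly Q (of_nat p)) (pr a0 r w))" by simp
    then show ?thesis using F(2)[OF q(3)] l(2) by (simp add: l.scale q_def)
  qed
  \<comment> \<open>The degree is at most 2 I + 2, while all integers from \<open>N\<close> to
    \<open>s - N\<close> are roots; the lower bound on \<open>r\<close> makes these too
    many.\<close>
  have "smult K F - Q = 0"
  proof (rule ccontr)
    assume nz: "smult K F - Q \<noteq> 0"
    have "degree Q \<le> 2" unfolding Q_def by (rule order.trans[OF degree_mult_le]) auto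
    then have "degree (smult K F - Q) \<le> 2 * I + 2"
      using F(1) by (intro degree_diff_le) (auto intro: order.trans[OF degree_smult_le])
    moreover have "of_nat ` {N..s - N} \<subseteq> {x. poly (smult K F - Q) x = 0}"
      using eq by auto
    then have "card (of_nat ` {N..s - N} :: complex set) \<le> degree (smult K F - Q)"
      by (rule order.trans[OF card_mono[OF poly_roots_finite[OF nz]] card_poly_roots_bound[OF nz]])
    moreover have "card (of_nat ` {N..s - N} :: complex set) = Suc (s - N) - N"
      by (subst card_image) (auto intro: inj_onI)
    ultimately show False using r by (simp add: s_def)
  qed
  then have "poly Q 0 = K * poly F 0" by (metis poly_smult right_minus_eq)
  also have "poly F 0 = 0" using F(2)[of 0] top[of s] by (simp add: w_def s_def l.zero)
  finally have "poly Q 0 = 0" by simp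
  moreover have "poly Q 0 = - ((of_nat s * e - of_nat n0) * (of_nat r + of_nat n0))"
  proof -
    have "- of_nat s - of_nat n0 + 1 = - (of_nat r + of_nat n0 :: complex)" by (simp add: s_def)
    moreover have "poly Q 0 = (of_nat s * e - of_nat n0) * (- of_nat s - of_nat n0 + 1)"
      by (simp add: Q_def)
    ultimately show ?thesis by (simp only: mult_minus_right)
  qed
  ultimately have "(of_nat s * e - of_nat n0) * (of_nat r + of_nat n0) = 0" by simp
  moreover have "of_nat r + of_nat n0 \<noteq> (0 :: complex)" using r by (simp flip: of_nat_add)
  moreover have "of_nat s * e - of_nat n0 \<noteq> 0"
    using n0 by (auto simp: e_def s_def simp del: of_nat_Suc)
  ultimately show False by simp
qed

lemma primary_uniform_bound: "\<exists>R. \<forall>b \<Delta>. primary a0 0 \<Delta> b \<longrightarrow> (\<forall>n\<ge>R. pr b n v = 0)"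
proof -
  obtain I where I: "\<And>s w. binom_comb I s (\<lambda>p q. pr a0 p (pr a0 q w))" using binom_comb_a0 by blast
  obtain N0 where N0: "\<And>q. q \<ge> N0 \<Longrightarrow> pr a0 q v = 0" using pr_eventually_0 by blast
  define N where "N = Suc N0"
  have N: "\<And>q. q \<ge> N \<Longrightarrow> pr a0 q v = 0" "N \<ge> 1" using N0 by (auto simp: N_def)
  define R where "R = 2 * N + 2 * I + 2"
  have "pr b n v = 0" if b: "primary a0 0 \<Delta> b" and n: "n \<ge> R" for b \<Delta> n
  proof -
    define n0 :: nat where "n0 = (if \<Delta> = 1 then 1 else 0)"
    have step: "pr a0 r (pr b n0 v) = 0" if "r \<ge> R" "\<And>q. q > r \<Longrightarrow> pr a0 q (pr b n0 v) = 0" for r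
      using primary_top_bound[OF I N b n0_def] that by (simp add: R_def)
    obtain B where B: "\<And>q. q \<ge> B \<Longrightarrow> pr a0 q (pr b n0 v) = 0" using pr_eventually_0 by blast
    \<comment> \<open>Descent from \<open>B\<close>, which may depend on \<open>b\<close>, to
      \<open>R\<close>, which does not; at k = B the second condition is void.\<close>
    have "\<forall>r\<ge>R. r \<ge> B - k \<longrightarrow> pr a0 r (pr b n0 v) = 0" for k
    proof (induction k)
      case (Suc k)
      show ?case
      proof (intro allI impI)
        fix r assume r: "r \<ge> R" "r \<ge> B - Suc k"
        show "pr a0 r (pr b n0 v) = 0"
        proof (rule step[OF r(1)])
          fix q assume "q > r"
          then have "q \<ge> R" "q \<ge> B - k" using r by simp_all
          then show "pr a0 q (pr b n0 v) = 0" using Suc by blast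
        qed
      qed
    qed (simp add: B)
    from this[of B] have L: "pr a0 r (pr b n0 v) = 0" if "r \<ge> R" for r using that by simp
    have comm: "pr a0 p (pr b n0 v) = sc (of_nat p * (\<Delta> - 1) - of_nat n0) (pr b (p + n0 - 1) v)"
      if "p \<ge> N" for p
      using commutator_primary[OF b, of p n0 v] N(1)[OF that] by simp
    \<comment> \<open>The commutator with \<open>a0\<close> at index n (if \<Delta> = 1) or n + 1
      (otherwise) recovers \<open>pr b n v\<close> with a nonzero factor.\<close>
    show ?thesis
    proof (cases "\<Delta> = 1")
      case True
      have "sc (- 1) (pr b n v) = 0" using comm[of n] L[of n] n True by (simp add: n0_def R_def)
      then show ?thesis by (simp only: P.V.scale_eq_0_iff) simp
    next
      case False
      have "sc (of_nat (Suc n) * (\<Delta> - 1)) (pr b n v) = 0"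
        using comm[of "Suc n"] L[of "Suc n"] n False by (simp add: n0_def R_def del: of_nat_Suc)
      then show ?thesis using False by (simp only: P.V.scale_eq_0_iff) (simp del: of_nat_Suc)
    qed
  qed
  then show ?thesis by blast
qed

text \<open>On \<open>Z\<close>, h(T) is h(-\<partial>), so the case N = 0 concerns torsion vectors.
  In the step, \<open>pr a0 N\<close> has top products as image and its kernel lies in the previous
  space.\<close>

lemma fin_dim_bounded_torsion:
  assumes "h \<noteq> 0"
  shows "P.fin_dim {w. (\<forall>p\<ge>N. pr a0 p w = 0) \<and> poly_op sc T h w = 0}"
proof (induction N)
  case 0
  have "poly_op sc T g w = scaleM (pcompose g [:0, -1:]) w" if "w \<in> Z" for w g
  proof (induction g)
    case (pCons c g)
    have "scaleM (pcompose g [:0, -1:]) w \<in> Z" using that subspace_Z M.subspace_scale by blast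
    then have "T (scaleM (pcompose g [:0, -1:]) w) = - scaleM ([:0, 1:] * pcompose g [:0, -1:]) w"
      by (simp add: T_def Z_def)
    also have "\<dots> = scaleM ([:0, -1:] * pcompose g [:0, -1:]) w"
      by (simp flip: M.scale_minus_left)
    finally show ?case using pCons
      by (simp add: T.poly_op_pCons pcompose_pCons) (simp flip: M.scale_left_distrib)
  qed simp
  then have "{w. (\<forall>p\<ge>0. pr a0 p w = 0) \<and> poly_op sc T h w = 0}
      \<subseteq> {w. scaleM (pcompose h [:0, -1:]) w = 0}"
    by (auto simp: Z_def)
  moreover have "pcompose h [:0, -1:] \<noteq> 0" using assms by (auto simp: pcompose_eq_0_iff)
  then have "P.fin_dim {w. scaleM (pcompose h [:0, -1:]) w = 0}"
    by (rule P.fin_dim_torsion[OF finite_G span_G])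
  ultimately show ?case using fin_span_subset by blast
next
  case (Suc N)
  interpret pair: vector_space_pair sc sc ..
  let ?W = "\<lambda>N. {w. (\<forall>p\<ge>N. pr a0 p w = 0) \<and> poly_op sc T h w = 0}"
  show ?case
  proof (rule pair.fin_span_of_kernel[OF pr_linear[of a0 N]])
    show "P.V.subspace (?W (Suc N))"
      by (auto simp: P.V.subspace_def pr_add pr_scale T.poly_op_add T.poly_op_scale)
    show "P.fin_dim (pr a0 N ` ?W (Suc N))"
      by (rule fin_span_subset[OF fin_dim_top_coeffs]) (unfold Suc_le_eq, blast)
    have "?W (Suc N) \<inter> {w. pr a0 N w = 0} \<subseteq> ?W N"
      by (auto simp: le_Suc_eq) (metis le_neq_implies_less Suc_leI)
    then show "P.fin_dim (?W (Suc N) \<inter> {w. pr a0 N w = 0})"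
      using Suc fin_span_subset by blast
  qed
qed

text \<open>Each condition is the kernel of a map of finite rank, so by rank-nullity infinite
  dimension survives.\<close>

lemma subspace_common_kernel:
  assumes S: "A.V.subspace S" "\<not> A.fin_dim S" and J: "finite J"
    and fin: "\<And>n v. (n, v) \<in> J \<Longrightarrow> P.fin_dim ((\<lambda>a. pr a n v) ` S)"
  shows "\<not> A.fin_dim {a \<in> S. \<forall>(n, v)\<in>J. pr a n v = 0}"
  using J fin
proof (induction J rule: finite_induct)
  case empty
  then show ?case using S by simp
next
  case (insert k J)
  obtain n v where k: "k = (n, v)" by (cases k)
  interpret pair: vector_space_pair "\<lambda>c. scale [:c:]" sc ..
  let ?S = "{a \<in> S. \<forall>(n, v)\<in>J. pr a n v = 0}"
  have lin: "Vector_Spaces.linear (\<lambda>c. scale [:c:]) sc (\<lambda>a. pr a n v)"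
    by unfold_locales (simp_all add: pr_add_left pr_scale_left)
  have "A.V.subspace ?S"
    using S(1) by (auto simp: A.V.subspace_def pr_add_left pr_scale_left case_prod_beta)
  moreover have "P.fin_dim ((\<lambda>a. pr a n v) ` ?S)"
    using insert.prems[of n v] k by (auto intro: fin_span_subset)
  moreover have "\<not> A.fin_dim ?S" using insert by auto
  ultimately have "\<not> A.fin_dim (?S \<inter> {a. pr a n v = 0})"
    using pair.fin_span_of_kernel[OF lin] by blast
  also have "?S \<inter> {a. pr a n v = 0} = {a \<in> S. \<forall>(n, v)\<in>insert k J. pr a n v = 0}"
    by (auto simp: k)
  finally show ?case .
qed

lemma not_faithful_of_primary:
  assumes B: "\<And>b. b \<in> B \<Longrightarrow> \<exists>\<Delta>. primary a0 0 \<Delta> b" and inf: "\<not> A.fin_dim (A.V.span B)"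
  shows "\<not> faithful_action act"
proof -
  obtain h where h: "h \<noteq> 0" "\<And>v. poly_op sc T h v \<in> Z" using poly_op_T_uniform by blast
  obtain R where R: "\<And>v b \<Delta> n. primary a0 0 \<Delta> b \<Longrightarrow> n \<ge> R v \<Longrightarrow> pr b n v = 0"
    using primary_uniform_bound by metis
  obtain N where N: "\<And>v n. n \<ge> N v \<Longrightarrow> pr a0 n v = 0" using pr_eventually_0 by metis
  define S where "S = A.V.span B"
  have S: "A.V.subspace S" by (simp add: S_def)
  have RS: "pr a n v = 0" if "a \<in> S" "n \<ge> R v" for a n v
  proof -
    have "S \<subseteq> {a. pr a n v = 0}"
      unfolding S_def using B R that(2)
      by (intro A.V.span_minimal) (fastforce simp: A.V.subspace_def pr_add_left pr_scale_left)+
    then show ?thesis using that by blast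
  qed
  \<comment> \<open>Finitely many conditions suffice on the generators, since \<open>RS\<close>
    disposes of the indices from \<open>R v\<close> on.\<close>
  define J where "J = (\<Union>v\<in>G. {..<R v} \<times> {v})"
  have "P.fin_dim ((\<lambda>a. pr a n v) ` S)" for n v
  proof -
    \<comment> \<open>In the commutator of \<open>pr a0 p\<close> and \<open>pr b n\<close>,
      \<open>N v\<close> kills \<open>pr a0 p v\<close> and \<open>R v\<close> kills product p + n -
      1 of \<open>b\<close>, whence the extra 1.\<close>
    define M where "M = N v + R v + 1"
    let ?Q = "{w. (\<forall>p\<ge>M. pr a0 p w = 0) \<and> poly_op sc T h w = 0}"
    have "pr b n v \<in> ?Q" if "b \<in> B" for b
    proof -
      obtain \<Delta> where b: "primary a0 0 \<Delta> b" using B \<open>b \<in> B\<close> by blast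
      have "pr a0 p (pr b n v) = 0" if "p \<ge> M" for p
        using commutator_primary[OF b, of p n v] N[of v p] R[OF b, of v "p + n - 1"] that
        by (simp add: M_def)
      moreover have "poly_op sc T h (pr b n v) = pr b n (poly_op sc T h v)"
        using T_primary[OF b]
        by (intro T.poly_op_intertwine[OF pr_linear _ T_linear, symmetric]) simp
      then have "poly_op sc T h (pr b n v) = 0" using primary_kills_Z[OF b h(2)] by simp
      ultimately show ?thesis by blast
    qed
    moreover have "A.V.subspace {a. pr a n v \<in> ?Q}"
      by (auto simp: A.V.subspace_def pr_add_left pr_scale_left pr_add pr_scale T.poly_op_add T.poly_op_scale)
    ultimately have "S \<subseteq> {a. pr a n v \<in> ?Q}"
      unfolding S_def by (intro A.V.span_minimal) auto
    then show ?thesis by (intro fin_span_subset[OF fin_dim_bounded_torsion[OF h(1), of M]]) blast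
  qed
  moreover have "finite J" using finite_G by (simp add: J_def)
  ultimately have "\<not> A.fin_dim {a \<in> S. \<forall>(n, v)\<in>J. pr a n v = 0}"
    using subspace_common_kernel[OF S, of J] inf by (simp add: S_def)
  then have "\<not> {a \<in> S. \<forall>(n, v)\<in>J. pr a n v = 0} \<subseteq> {0}"
    using fin_span_subset[OF A.V.fin_span_zero] by blast
  then obtain a where a: "a \<in> S" "\<forall>(n, v)\<in>J. pr a n v = 0" "a \<noteq> 0" by blast
  have "pr a n v = 0" if "v \<in> G" for n v
    using a RS[OF a(1), of v n] that by (cases "n < R v") (auto simp: J_def)
  then have "M.span G \<subseteq> {v. \<forall>n. pr a n v = 0}"
    by (intro M.span_minimal subspace_annihilator) auto
  then have "act a v = 0" for v using span_G act_eq_0_iff by blast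
  then show ?thesis using a(3) unfolding faithful_action_def by blast
qed

end

section \<open>Conclusion: the cases \<alpha> = 0 and \<alpha> \<noteq> 0\<close>

theorem corollary4p1:
  fixes scale :: "complex poly \<Rightarrow> 'a::ab_group_add \<Rightarrow> 'a"
    and br :: "'a \<Rightarrow> 'a \<Rightarrow> 'a poly"
    and L :: "nat \<Rightarrow> 'a"
    and p :: "nat \<Rightarrow> nat \<Rightarrow> complex poly poly"
  assumes "lie_conformal_algebra scale br"
    and "free_graded_by scale L"
    and "\<And>i j. br (L i) (L j) = poly2_scale scale (p i j) (L (i + j))"
    and "br (L 0) (L 0) = poly2_scale scale [:[:0, 1:], [:2:]:] (L 0)"
    and "\<And>i. br (L 1) (L i) \<noteq> 0"
  shows "\<not> (\<exists>(scaleM :: complex poly \<Rightarrow> 'm::ab_group_add \<Rightarrow> 'm) act.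
              lie_conformal_module scale br scaleM act \<and> finite_module scaleM \<and>
              \<not> trivial_action act \<and> faithful_action act)"
proof
  assume "\<exists>(scaleM :: complex poly \<Rightarrow> 'm \<Rightarrow> 'm) act.
              lie_conformal_module scale br scaleM act \<and> finite_module scaleM \<and>
              \<not> trivial_action act \<and> faithful_action act"
  then obtain scaleM :: "complex poly \<Rightarrow> 'm \<Rightarrow> 'm" and act and G
    where module: "lie_conformal_module scale br scaleM act" and faithful: "faithful_action act"
      and G: "finite G" "module.span scaleM G = UNIV"
    unfolding finite_module_def by blast
  interpret L: graded_virasoro scale br L p
    using assms by (intro graded_virasoro.intro graded_virasoro_axioms.intro)
  interpret lie_conformal_module scale br scaleM act by fact
  interpret virasoro_module scale br scaleM act "L 0" G
    by unfold_locales (use L.primary_L0 G in auto)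
  \<comment> \<open>The predicate \<open>primary\<close> involves the bracket alone, so what the
    adjoint module yields carries over to the given module.\<close>
  obtain \<alpha> \<Delta> where prim: "\<And>i. primary (L 0) (of_nat i * \<alpha>) (\<Delta> i) (L i)"
    using L.primary_L by blast
  show False
  proof (cases "\<alpha> = 0")
    case True
    have "\<exists>\<Delta>. primary (L 0) 0 \<Delta> b" if "b \<in> range L" for b using that prim True by auto
    then show False using not_faithful_of_primary L.not_fin_dim_span_L faithful by blast
  next
    case False
    obtain C where C: "finite C"
      "\<And>b c \<Delta>. primary (L 0) c \<Delta> b \<Longrightarrow> \<exists>v. act b v \<noteq> 0 \<Longrightarrow> c \<in> C"
      using finite_weights by blast
    \<comment> \<open>Faithfulness makes every \<open>L i\<close> act nontrivially, so infinitely
      many distinct weights would lie in a finite set.\<close>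
    have "of_nat i * \<alpha> \<in> C" for i
    proof (rule C(2)[OF prim])
      have "L i \<noteq> 0" using L.L_free[of 1 i] by auto
      then show "\<exists>v. act (L i) v \<noteq> 0" using faithful by (auto simp: faithful_action_def)
    qed
    then have "range (\<lambda>i. of_nat i * \<alpha>) \<subseteq> C" by blast
    moreover have "inj (\<lambda>i. of_nat i * \<alpha>)" using False by (auto intro: injI)
    ultimately show False using C(1) finite_subset finite_imageD infinite_UNIV_nat by metis
  qed
qed

end
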